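(* Let $n\ge 0$ be an integer and let $m_-,m_+\in\mathbb{Z}+\tfrac12$ with $m_+>0$. Consider the morphism of complex algebraic tori $$\phi_{T,m_-,m_+}:T^n\to T^{\,n+m_+-1/2},\qquad \phi_{T,m_-,m_+}(t_1,\dots,t_n)=\bigl(t_1,\dots,t_n,\,v,\,v^{3},\,\dots,\,v^{2(m_+-1)}\bigr),$$ where the last $m_+-\tfrac12$ coordinates are the odd powers $v^{2k-1}$, $1\le k\le m_+-\tfrac12$ (there are none if $m_+=\tfrac12$). Then $\phi_{T,m_-,m_+}$ is a spectral transfer morphism from the normalised affine Hecke algebra with $\mu$-function $\mu^{\,n}_{m_-,m_+}$ to the normalised affine Hecke algebra with $\mu$-function $\mu^{\,n+m_+-1/2}_{m_-,m_+-1}$ (both with $b=1$).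
   Context: Throughout $v>1$ is a real parameter, $q=v^2$, and $T^N=(\mathbb{C}^\times)^N$ with coordinates $t_1,\dots,t_N$ and character lattice $X=\mathbb{Z}^N$ (characters written multiplicatively). $R_0$ is the root system of type $B_N$ in $X$: short roots $t_i^{\pm1}$ and long roots $t_i^{\pm1}t_j^{\pm1}$ ($i<j$, all signs), with a fixed set $R_0^+$ of positive roots. **Parameters and $\mu$-function.** Let $b$ be a positive integer (here $b=1$) and let $m_\pm$ be real numbers. Define functions $\mathtt m_\pm$ on $R_0$ by $\mathtt m_+(\alpha)=b$, $\mathtt m_-(\alpha)=0$ for long $\alpha$, and $\mathtt m_+(\alpha)=b\,m_+$, $\mathtt m_-(\alpha)=b\,m_-$ for short $\alpha$. The $\mu$-function with normalisation factor $d=d(v)$ is $$\mu_{\mathtt m,d}=d\,v^{-2\sum_{\alpha\in R_0^+}(\mathtt m_+(\alpha)+\mathtt m_-(\alpha))}\prod_{\alpha\in R_0}\frac{1-\alpha^{-2}}{(1-v^{-2\mathtt m_+(\alpha)}\alpha^{-1})(1+v^{-2\mathtt m_-(\alpha)}\alpha^{-1})}.$$ Write $\mu^N_{m_-,m_+}$ for this function on $T^N$ with $b=1$ and $$d=d^N_{m_-,m_+}=(v-v^{-1})^{-N}\prod_{i=1}^{\lfloor |m_--m_+|\rfloor}\Bigl(\frac{v^{|m_--m_+|-i}}{1+q^{|m_--m_+|-i}}\Bigr)^{i}\prod_{j=1}^{\lfloor |m_-+m_+|\rfloor}\Bigl(\frac{v^{|m_-+m_+|-j}}{1+q^{|m_-+m_+|-j}}\Bigr)^{j}.$$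 **Residual cosets.** Let $L\subset T$ be a coset of a subtorus $T^L\subset T$. Put, for $\epsilon=\pm$, $$p_\epsilon(L)=\{\alpha\in R_0:\epsilon\alpha|_L= v^{-2\mathtt m_\epsilon(\alpha)}\},\qquad z_\epsilon(L)=\{\alpha\in R_0:\epsilon\alpha|_L= 1\}$$ (here $\epsilon\alpha$ means the function $\pm\alpha$, i.e. the character value multiplied by the sign). $L$ is residual if $|p_+(L)|+|p_-(L)|-|z_+(L)|-|z_-(L)|=\operatorname{codim}(L)$. For $L$ residual, the regularisation of $\mu_{\mathtt m,d}$ along $L$ is $$\mu^L_{\mathtt m,d}=\frac{d\,v^{-2\sum_{\alpha\in R_0^+}(\mathtt m_+(\alpha)+\mathtt m_-(\alpha))}\prod_{\alpha\in R_0\setminus z_-(L)}(1+\alpha^{-1})\prod_{\alpha\in R_0\setminus z_+(L)}(1-\alpha^{-1})}{\prod_{\alpha\in R_0\setminus p_-(L)}(1+v^{-2\mathtt m_-(\alpha)}\alpha^{-1})\prod_{\alpha\in R_0\setminus p_+(L)}(1-v^{-2\mathtt m_+(\alpha)}\alpha^{-1})},$$ and $\mu^{(L)}_{\mathtt m,d}$ denotes its restriction to $L$, a nonzero rational function. Let $R_L\subset R_0$ be the set of roots that are constant on $L$, and let $T_L\subset T$ be the subtorus whose cocharacter lattice is $Y\cap\mathbb{Q}R_L^\vee$, where $Y$ is the cocharacter lattice of $T$. **Spectral transfer morphism.** Given two normalised affine Hecke algebras with tori $T_1,T_2$ and $\mu$-functions $\mu_1,\mu_2$, and a residual coset $L\subset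 T_2$ for $\mu_2$, a morphism $\phi_T:T_1\to T_2$ with image $L$ is a spectral transfer morphism if: (T1) $\phi_T$ is a finite morphism of algebraic varieties; (T2) $\phi_T$ maps the identity $e$ of $T_1$ into $L\cap T_L$, and when $\phi_T(e)$ is declared to be the base point (identity) of $L$, $\phi_T$ becomes a homomorphism of algebraic tori; (T3) there is a constant $c\in\mathbb{Q}^\times$, independent of $v$, with $\phi_T^*\bigl(\mu_2^{(L)}\bigr)=c\,\mu_1$. Thus part of the assertion is that the image of the morphism is a residual coset of the target. *)

theory Defs
  imports Complex_Main "HOL-Algebra.Product_Groups" "HOL-Algebra.Generated_Groups"
begin

section \<open>Complex tori and their algebraic geometry\<close>

definition Cstar :: "complex monoid" where
  "Cstar = \<lparr>carrier = - {0}, mult = (*), one = 1\<rparr>"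

definition torus :: "nat \<Rightarrow> (nat \<Rightarrow> complex) monoid" where
  "torus N = product_group {1..N} (\<lambda>_. Cstar)"

text \<open>The lattice \<open>\<int>\<^sup>N\<close>, used both as character lattice \<open>X\<close> and cocharacter lattice \<open>Y\<close> of
  \<^term>\<open>torus N\<close>; the two are dual under the standard pairing. Elements vanish outside \<open>{1..N}\<close>.\<close>

definition lattice_Z :: "nat \<Rightarrow> (nat \<Rightarrow> int) set" where
  "lattice_Z N = {x. \<forall>i. i \<notin> {1..N} \<longrightarrow> x i = 0}"

definition charval :: "nat \<Rightarrow> (nat \<Rightarrow> int) \<Rightarrow> (nat \<Rightarrow> complex) \<Rightarrow> complex" where
  "charval N x t = (\<Prod>i\<in>{1..N}. t i powi x i)"

definition cocharval :: "nat \<Rightarrow> (nat \<Rightarrow> int) \<Rightarrow> complex \<Rightarrow> (nat \<Rightarrow> complex)" where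
  "cocharval N y z = (\<lambda>i\<in>{1..N}. z powi y i)"

text \<open>The coordinate ring of the torus (Laurent polynomials), as functions; only the values on
  the torus matter.\<close>

definition regular_funs :: "nat \<Rightarrow> ((nat \<Rightarrow> complex) \<Rightarrow> complex) set" where
  "regular_funs N = {f. \<exists>A c. finite A \<and> A \<subseteq> lattice_Z N \<and>
     (\<forall>t\<in>carrier (torus N). f t = (\<Sum>x\<in>A. c x * charval N x t))}"

definition variety_morphism ::
    "nat \<Rightarrow> nat \<Rightarrow> ((nat \<Rightarrow> complex) \<Rightarrow> (nat \<Rightarrow> complex)) \<Rightarrow> bool" where
  "variety_morphism M N \<phi> \<longleftrightarrow>
     \<phi> ` carrier (torus M) \<subseteq> carrier (torus N) \<and>
     (\<forall>g\<in>regular_funs N. (\<lambda>t. g (\<phi> t)) \<in> regular_funs M)"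

text \<open>A morphism of affine varieties is finite if the source coordinate ring is a finitely
  generated module over the target coordinate ring, acting through pullback.\<close>

definition finite_morphism ::
    "nat \<Rightarrow> nat \<Rightarrow> ((nat \<Rightarrow> complex) \<Rightarrow> (nat \<Rightarrow> complex)) \<Rightarrow> bool" where
  "finite_morphism M N \<phi> \<longleftrightarrow> variety_morphism M N \<phi> \<and>
     (\<exists>B. finite B \<and> B \<subseteq> regular_funs M \<and>
        (\<forall>f\<in>regular_funs M. \<exists>g. (\<forall>b\<in>B. g b \<in> regular_funs N) \<and>
           (\<forall>t\<in>carrier (torus M). f t = (\<Sum>b\<in>B. g b (\<phi> t) * b t))))"

text \<open>Subtori are the closed subgroups isomorphic, as algebraic groups, to a torus. Surjectivity of
  the pullback on coordinate rings says that \<open>\<psi>\<close> is a closed immersion (hence injective).\<close>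

definition subtorus_of_dim :: "nat \<Rightarrow> nat \<Rightarrow> (nat \<Rightarrow> complex) set \<Rightarrow> bool" where
  "subtorus_of_dim N r S \<longleftrightarrow>
     (\<exists>\<psi>. \<psi> \<in> hom (torus r) (torus N) \<and> variety_morphism r N \<psi> \<and>
        (\<forall>f\<in>regular_funs r. \<exists>g\<in>regular_funs N. \<forall>t\<in>carrier (torus r). f t = g (\<psi> t)) \<and>
        S = \<psi> ` carrier (torus r))"

text \<open>The subtorus with a given (saturated) cocharacter lattice \<open>Y'\<close>, i.e. the image of
  \<open>Y' \<otimes> \<complex>\<^sup>\<times>\<close>.\<close>

definition subtorus_with_lattice :: "nat \<Rightarrow> (nat \<Rightarrow> int) set \<Rightarrow> (nat \<Rightarrow> complex) set" where
  "subtorus_with_lattice N Y' =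
     generate (torus N) {cocharval N y z | y z. y \<in> Y' \<and> z \<noteq> 0}"

text \<open>Rational functions on the irreducible variety \<^term>\<open>torus N\<close> are represented by total functions
  that are meaningful on a dense open set; they are equal if they agree on a nonempty Zariski open
  set (equivalently, on some nonempty basic open set \<open>h \<noteq> 0\<close>). Arbitrary values such as
  \<open>x / 0 = 0\<close> thereby play no role.\<close>

definition rational_fun_eq ::
    "nat \<Rightarrow> ((nat \<Rightarrow> complex) \<Rightarrow> complex) \<Rightarrow> ((nat \<Rightarrow> complex) \<Rightarrow> complex) \<Rightarrow> bool" where
  "rational_fun_eq N f g \<longleftrightarrow>
     (\<exists>h\<in>regular_funs N. (\<exists>t\<in>carrier (torus N). h t \<noteq> 0) \<and>
        (\<forall>t\<in>carrier (torus N). h t \<noteq> 0 \<longrightarrow> f t = g t))"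

section \<open>The root system of type B\<close>

definition short_roots :: "nat \<Rightarrow> (nat \<Rightarrow> int) set" where
  "short_roots N = {\<lambda>k. if k = i then s else 0 | i s. i \<in> {1..N} \<and> s \<in> {1, -1}}"

definition long_roots :: "nat \<Rightarrow> (nat \<Rightarrow> int) set" where
  "long_roots N = {\<lambda>k. if k = i then s else if k = j then s' else 0 | i j s s'.
     i \<in> {1..N} \<and> j \<in> {1..N} \<and> i < j \<and> s \<in> {1, -1} \<and> s' \<in> {1, -1}}"

definition roots_B :: "nat \<Rightarrow> (nat \<Rightarrow> int) set" where
  "roots_B N = short_roots N \<union> long_roots N"

text \<open>Sets of positive roots: the roots on the positive side of a hyperplane containing no root.\<close>

definition positive_roots :: "nat \<Rightarrow> (nat \<Rightarrow> int) set \<Rightarrow> bool" where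
  "positive_roots N P \<longleftrightarrow> (\<exists>f :: nat \<Rightarrow> real.
     (\<forall>\<alpha>\<in>roots_B N. (\<Sum>i\<in>{1..N}. f i * of_int (\<alpha> i)) \<noteq> 0) \<and>
     P = {\<alpha>\<in>roots_B N. (\<Sum>i\<in>{1..N}. f i * of_int (\<alpha> i)) > 0})"

text \<open>\<open>\<alpha>\<^sup>\<or> = 2\<alpha> / (\<alpha>, \<alpha>)\<close>; the division is exact since \<open>(\<alpha>, \<alpha>)\<close> is 1 or 2.\<close>

definition coroot :: "nat \<Rightarrow> (nat \<Rightarrow> int) \<Rightarrow> (nat \<Rightarrow> int)" where
  "coroot N \<alpha> = (\<lambda>i. 2 * \<alpha> i div (\<Sum>j\<in>{1..N}. \<alpha> j * \<alpha> j))"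

section \<open>Normalised affine Hecke algebras: parameters and the mu-function\<close>

text \<open>The data of a normalised affine Hecke algebra with root system \<open>B\<^sub>N\<close> in \<open>\<int>\<^sup>N\<close>. The normalisation
  factor is a function of \<open>v\<close>.\<close>

record hecke_data =
  rank :: nat
  pos_roots :: "(nat \<Rightarrow> int) set"
  base_par :: nat
  par_minus :: real
  par_plus :: real
  norm_factor :: "real \<Rightarrow> real"

definition m_plus :: "hecke_data \<Rightarrow> (nat \<Rightarrow> int) \<Rightarrow> real" where
  "m_plus H \<alpha> = (if \<alpha> \<in> long_roots (rank H) then real (base_par H)
                 else real (base_par H) * par_plus H)"

definition m_minus :: "hecke_data \<Rightarrow> (nat \<Rightarrow> int) \<Rightarrow> real" where
  "m_minus H \<alpha> = (if \<alpha> \<in> long_roots (rank H) then 0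
                  else real (base_par H) * par_minus H)"

definition vpow :: "real \<Rightarrow> real \<Rightarrow> complex" where
  "vpow v a = complex_of_real (v powr a)"

definition mu_prefactor :: "hecke_data \<Rightarrow> real \<Rightarrow> complex" where
  "mu_prefactor H v = complex_of_real (norm_factor H v) *
     vpow v (- 2 * (\<Sum>\<alpha>\<in>pos_roots H. m_plus H \<alpha> + m_minus H \<alpha>))"

definition mu_fun :: "hecke_data \<Rightarrow> real \<Rightarrow> (nat \<Rightarrow> complex) \<Rightarrow> complex" where
  "mu_fun H v t = mu_prefactor H v *
     (\<Prod>\<alpha>\<in>roots_B (rank H).
        (1 - charval (rank H) \<alpha> t powi (-2)) /
        ((1 - vpow v (- 2 * m_plus H \<alpha>) * charval (rank H) \<alpha> t powi (-1)) *
         (1 + vpow v (- 2 * m_minus H \<alpha>) * charval (rank H) \<alpha> t powi (-1))))"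

section \<open>Residual cosets and regularisation\<close>

definition p_plus :: "hecke_data \<Rightarrow> real \<Rightarrow> (nat \<Rightarrow> complex) set \<Rightarrow> (nat \<Rightarrow> int) set" where
  "p_plus H v L = {\<alpha>\<in>roots_B (rank H). \<forall>t\<in>L. charval (rank H) \<alpha> t = vpow v (- 2 * m_plus H \<alpha>)}"

definition p_minus :: "hecke_data \<Rightarrow> real \<Rightarrow> (nat \<Rightarrow> complex) set \<Rightarrow> (nat \<Rightarrow> int) set" where
  "p_minus H v L = {\<alpha>\<in>roots_B (rank H). \<forall>t\<in>L. - charval (rank H) \<alpha> t = vpow v (- 2 * m_minus H \<alpha>)}"

definition z_plus :: "hecke_data \<Rightarrow> (nat \<Rightarrow> complex) set \<Rightarrow> (nat \<Rightarrow> int) set" where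
  "z_plus H L = {\<alpha>\<in>roots_B (rank H). \<forall>t\<in>L. charval (rank H) \<alpha> t = 1}"

definition z_minus :: "hecke_data \<Rightarrow> (nat \<Rightarrow> complex) set \<Rightarrow> (nat \<Rightarrow> int) set" where
  "z_minus H L = {\<alpha>\<in>roots_B (rank H). \<forall>t\<in>L. - charval (rank H) \<alpha> t = 1}"

definition residual_coset :: "hecke_data \<Rightarrow> real \<Rightarrow> (nat \<Rightarrow> complex) set \<Rightarrow> bool" where
  "residual_coset H v L \<longleftrightarrow>
     (\<exists>r S s. subtorus_of_dim (rank H) r S \<and> s \<in> carrier (torus (rank H)) \<and>
        L = s <#\<^bsub>torus (rank H)\<^esub> S \<and>
        int (card (p_plus H v L)) + int (card (p_minus H v L))
          - int (card (z_plus H L)) - int (card (z_minus H L)) = int (rank H) - int r)"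

text \<open>The regularisation of the mu-function along \<open>L\<close>, to be evaluated at points of \<open>L\<close>.\<close>

definition mu_reg ::
    "hecke_data \<Rightarrow> real \<Rightarrow> (nat \<Rightarrow> complex) set \<Rightarrow> (nat \<Rightarrow> complex) \<Rightarrow> complex" where
  "mu_reg H v L t = mu_prefactor H v *
     (\<Prod>\<alpha>\<in>roots_B (rank H) - z_minus H L. 1 + charval (rank H) \<alpha> t powi (-1)) *
     (\<Prod>\<alpha>\<in>roots_B (rank H) - z_plus H L. 1 - charval (rank H) \<alpha> t powi (-1)) /
     ((\<Prod>\<alpha>\<in>roots_B (rank H) - p_minus H v L.
         1 + vpow v (- 2 * m_minus H \<alpha>) * charval (rank H) \<alpha> t powi (-1)) *
      (\<Prod>\<alpha>\<in>roots_B (rank H) - p_plus H v L.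
         1 - vpow v (- 2 * m_plus H \<alpha>) * charval (rank H) \<alpha> t powi (-1)))"

definition const_roots :: "hecke_data \<Rightarrow> (nat \<Rightarrow> complex) set \<Rightarrow> (nat \<Rightarrow> int) set" where
  "const_roots H L = {\<alpha>\<in>roots_B (rank H). \<exists>c. \<forall>t\<in>L. charval (rank H) \<alpha> t = c}"

text \<open>The subtorus \<open>T\<^sub>L\<close> with cocharacter lattice \<open>Y \<inter> \<rat>R\<^sub>L\<^sup>\<or>\<close>.\<close>

definition T_sub :: "hecke_data \<Rightarrow> (nat \<Rightarrow> complex) set \<Rightarrow> (nat \<Rightarrow> complex) set" where
  "T_sub H L = subtorus_with_lattice (rank H)
     {y \<in> lattice_Z (rank H). \<exists>r :: (nat \<Rightarrow> int) \<Rightarrow> rat.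
        \<forall>i. of_int (y i) = (\<Sum>\<alpha>\<in>const_roots H L. r \<alpha> * of_int (coroot (rank H) \<alpha> i))}"

section \<open>Spectral transfer morphisms\<close>

text \<open>A coset \<open>L\<close> of a subgroup of \<open>G\<close>, made into a group with identity \<open>a \<in> L\<close>.\<close>

definition based_coset :: "'a monoid \<Rightarrow> 'a set \<Rightarrow> 'a \<Rightarrow> 'a monoid" where
  "based_coset G L a =
     \<lparr>carrier = L, mult = (\<lambda>x y. x \<otimes>\<^bsub>G\<^esub> y \<otimes>\<^bsub>G\<^esub> inv\<^bsub>G\<^esub> a), one = a\<rparr>"

text \<open>The morphism \<open>\<phi> v\<close> and its image depend on \<open>v > 1\<close>, the constant \<open>c\<close> does not.\<close>

definition spectral_transfer_morphism ::
    "hecke_data \<Rightarrow> hecke_data \<Rightarrow> (real \<Rightarrow> (nat \<Rightarrow> complex) \<Rightarrow> (nat \<Rightarrow> complex)) \<Rightarrow> bool" where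
  "spectral_transfer_morphism H1 H2 \<phi> \<longleftrightarrow>
     (\<exists>c :: rat. c \<noteq> 0 \<and>
       (\<forall>v > 1. let T1 = torus (rank H1); T2 = torus (rank H2);
                    L = \<phi> v ` carrier T1; e = \<phi> v \<one>\<^bsub>T1\<^esub> in
          residual_coset H2 v L \<and>
          finite_morphism (rank H1) (rank H2) (\<phi> v) \<and>
          e \<in> L \<inter> T_sub H2 L \<and>
          \<phi> v \<in> hom T1 (based_coset T2 L e) \<and>
          rational_fun_eq (rank H1)
            (\<lambda>t. mu_reg H2 v L (\<phi> v t)) (\<lambda>t. of_rat c * mu_fun H1 v t)))"

section \<open>The algebras and the morphism of the theorem\<close>

definition d_factor :: "nat \<Rightarrow> real \<Rightarrow> real \<Rightarrow> real \<Rightarrow> real" where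
  "d_factor N mm mp v =
     (let q = v ^ 2; a = \<bar>mm - mp\<bar>; b = \<bar>mm + mp\<bar> in
      (v - inverse v) powi (- int N) *
      (\<Prod>i = 1..nat \<lfloor>a\<rfloor>. (v powr (a - real i) / (1 + q powr (a - real i))) ^ i) *
      (\<Prod>j = 1..nat \<lfloor>b\<rfloor>. (v powr (b - real j) / (1 + q powr (b - real j))) ^ j))"

text \<open>The algebra with mu-function \<open>\<mu>\<^sup>N\<close> for parameters \<open>mm\<close>, \<open>mp\<close>, base parameter 1 and
  positive roots \<open>P\<close>.\<close>

definition hecke_B :: "(nat \<Rightarrow> int) set \<Rightarrow> nat \<Rightarrow> real \<Rightarrow> real \<Rightarrow> hecke_data" where
  "hecke_B P N mm mp =
     \<lparr>rank = N, pos_roots = P, base_par = 1, par_minus = mm, par_plus = mp,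
      norm_factor = d_factor N mm mp\<rparr>"

text \<open>\<open>(t\<^sub>1, \<dots>, t\<^sub>n) \<mapsto> (t\<^sub>1, \<dots>, t\<^sub>n, v, v\<^sup>3, \<dots>, v\<^sup>2\<^sup>k\<^sup>-\<^sup>1)\<close>\<close>

definition phi_T :: "nat \<Rightarrow> nat \<Rightarrow> real \<Rightarrow> (nat \<Rightarrow> complex) \<Rightarrow> (nat \<Rightarrow> complex)" where
  "phi_T n k v t =
     (\<lambda>i\<in>{1..n + k}. if i \<le> n then t i else complex_of_real v ^ (2 * (i - n) - 1))"

end

theory Submission
  imports Defs
begin

text \<open>
  Why the theorem holds. Write \<open>q = v\<^sup>2\<close> and let \<open>L\<close> be the image of \<open>\<phi>\<close>, the set of points whose last
  \<open>k = m\<^sub>+ - 1/2\<close> coordinates are \<open>v, v\<^sup>3, \<dots>, v\<^sup>2\<^sup>k\<^sup>-\<^sup>1\<close>. A coordinate embedding is a closed immersion and a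
  homomorphism up to translation, so everything except residuality and the comparison of
  \<open>\<mu>\<close>-functions is formal; the base point lies in \<open>T\<^sub>L\<close> because the short roots in the last \<open>k\<close>
  directions are constant on \<open>L\<close>.

  A root involving one of the first \<open>n\<close> coordinates is not constant on \<open>L\<close>; the others take values
  \<open>v\<^sup>e\<close> with \<open>e \<noteq> 0\<close>. Hence \<open>z\<^sub>+\<close>, \<open>z\<^sub>-\<close> and \<open>p\<^sub>-\<close> are empty, and comparing exponents with \<open>-2\<close> (long
  roots) and \<open>1 - 2k\<close> (short roots) leaves exactly \<open>k\<close> elements in \<open>p\<^sub>+\<close>
  (\<open>p_plus_phi_coset\<close>), which is the codimension.

  For the \<open>\<mu>\<close>-function the roots of \<open>B\<^sub>n\<^sub>+\<^sub>k\<close> are sorted into three families. Long roots in the first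
  \<open>n\<close> coordinates contribute the same factor on both sides. For fixed \<open>i \<le> n\<close> the mixed roots
  \<open>t\<^sub>i\<^sup>\<plusminus>\<^sup>1 t\<^sub>n\<^sub>+\<^sub>b\<^sup>\<plusminus>\<^sup>1\<close> telescope, because the special coordinates form a chain with ratio \<open>v\<^sup>2\<close>, the
  parameter of a long root; what remains shifts the parameter of the short roots \<open>t\<^sub>i\<^sup>\<plusminus>\<^sup>1\<close> from
  \<open>m\<^sub>+ - 1\<close> to \<open>m\<^sub>+\<close>, at the cost of a power of \<open>v\<close> (\<open>mixed_factors\<close>). The constant roots contribute
  a function of \<open>v\<close> alone. Its long part telescopes too, and together with the short numerators
  yields, up to sign, a power of \<open>v\<close> times \<open>(q - 1)\<^sup>k\<close>, the factor by which \<open>(v - v\<inverse>)\<^sup>-\<^sup>N\<close> changes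
  (\<open>constant_factors\<close>). Only the factors with \<open>m\<^sub>-\<close> survive; they are, up to a power of \<open>v\<close>, the
  product of \<open>g(j) = 1 / (v\<^sup>j + v\<^sup>-\<^sup>j)\<close> over the \<open>2k\<close> consecutive integers \<open>m\<^sub>- - m\<^sub>+ < j < m\<^sub>- + m\<^sub>+\<close>.

  The normalisation factors are built from a discrete Barnes function \<open>E\<close> on the integers,
  whose second difference quotient is \<open>g\<close>, except that at \<open>0\<close>, where \<open>E\<close> is reflected, the quotient
  is \<open>g(0)\<^sup>2 = g(0) / 2\<close> (\<open>barnes_ratio_step\<close>). So the quotient of the two normalisation factors
  cancels the product of the \<open>g(j)\<close> up to a factor \<open>1/2\<close>, present exactly when \<open>0\<close> is among these
  integers \<open>j\<close> (\<open>d_factor_ratio\<close>). All powers of \<open>v\<close> cancel, and the constant is \<open>1\<close> if \<open>k = 0\<close> and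
  \<open>-1\<close> or \<open>-2\<close> otherwise.
\<close>

section \<open>Regular functions on tori and coordinate embeddings\<close>

lemma carrier_torus: "carrier (torus N) = (\<Pi>\<^sub>E i\<in>{1..N}. - {0})"
  by (simp add: torus_def Cstar_def)

lemma mult_torus: "x \<otimes>\<^bsub>torus N\<^esub> y = (\<lambda>i\<in>{1..N}. x i * y i)"
  by (simp add: torus_def Cstar_def)

lemma one_torus: "\<one>\<^bsub>torus N\<^esub> = (\<lambda>i\<in>{1..N}. 1)"
  by (simp add: torus_def Cstar_def)

lemma group_Cstar: "group Cstar"
proof (rule groupI)
  fix x assume "x \<in> carrier Cstar"
  then show "\<exists>y\<in>carrier Cstar. y \<otimes>\<^bsub>Cstar\<^esub> x = \<one>\<^bsub>Cstar\<^esub>"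
    by (intro bexI[of _ "inverse x"]) (auto simp: Cstar_def)
qed (auto simp: Cstar_def)

lemma group_torus: "group (torus N)"
  by (simp add: torus_def group_Cstar)

lemma inv_torus:
  assumes "x \<in> carrier (torus N)"
  shows "inv\<^bsub>torus N\<^esub> x = (\<lambda>i\<in>{1..N}. inverse (x i))"
proof (rule group.inv_equality[OF group_torus])
  show "(\<lambda>i\<in>{1..N}. inverse (x i)) \<otimes>\<^bsub>torus N\<^esub> x = \<one>\<^bsub>torus N\<^esub>"
    using assms by (auto simp: mult_torus one_torus carrier_torus PiE_iff fun_eq_iff)
qed (use assms in \<open>auto simp: carrier_torus PiE_iff\<close>)

lemma charval_add:
  assumes "t \<in> carrier (torus N)"
  shows "charval N (\<lambda>i. x i + y i) t = charval N x t * charval N y t"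
  using assms unfolding charval_def prod.distrib[symmetric]
  by (intro prod.cong) (auto simp: carrier_torus PiE_iff power_int_add)

lemma charval_zero: "charval N (\<lambda>_. 0) t = 1"
  by (simp add: charval_def)

lemma regular_charval: "x \<in> lattice_Z N \<Longrightarrow> charval N x \<in> regular_funs N"
  unfolding regular_funs_def by (intro CollectI exI[of _ "{x}"] exI[of _ "\<lambda>_. 1"]) auto

lemma regular_scale:
  assumes "f \<in> regular_funs N" shows "(\<lambda>t. c * f t) \<in> regular_funs N"
proof -
  obtain A d where "finite A" "A \<subseteq> lattice_Z N"
    "\<forall>t\<in>carrier (torus N). f t = (\<Sum>x\<in>A. d x * charval N x t)"
    using assms unfolding regular_funs_def by blast
  then show ?thesis unfolding regular_funs_def
    by (intro CollectI exI[of _ A] exI[of _ "\<lambda>x. c * d x"]) (auto simp: sum_distrib_left mult.assoc)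
qed

lemma regular_cong:
  assumes "f \<in> regular_funs N" "\<And>t. t \<in> carrier (torus N) \<Longrightarrow> g t = f t"
  shows "g \<in> regular_funs N"
  using assms unfolding regular_funs_def by auto

lemma regular_add:
  assumes "f \<in> regular_funs N" "g \<in> regular_funs N" shows "(\<lambda>t. f t + g t) \<in> regular_funs N"
proof -
  obtain A c where A: "finite A" "A \<subseteq> lattice_Z N"
    "\<forall>t\<in>carrier (torus N). f t = (\<Sum>x\<in>A. c x * charval N x t)"
    using assms unfolding regular_funs_def by blast
  obtain B d where B: "finite B" "B \<subseteq> lattice_Z N"
    "\<forall>t\<in>carrier (torus N). g t = (\<Sum>x\<in>B. d x * charval N x t)"
    using assms unfolding regular_funs_def by blast
  let ?e = "\<lambda>x. (if x \<in> A then c x else 0) + (if x \<in> B then d x else 0)"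
  have "f t + g t = (\<Sum>x\<in>A \<union> B. ?e x * charval N x t)" if t: "t \<in> carrier (torus N)" for t
  proof -
    have "f t = (\<Sum>x\<in>A \<union> B. (if x \<in> A then c x else 0) * charval N x t)"
      unfolding A(3)[rule_format, OF t] using A(1) B(1) by (intro sum.mono_neutral_cong_left) auto
    moreover have "g t = (\<Sum>x\<in>A \<union> B. (if x \<in> B then d x else 0) * charval N x t)"
      unfolding B(3)[rule_format, OF t] using A(1) B(1) by (intro sum.mono_neutral_cong_left) auto
    ultimately show ?thesis by (simp add: sum.distrib distrib_right)
  qed
  then show ?thesis unfolding regular_funs_def using A B
    by (intro CollectI exI[of _ "A \<union> B"] exI[of _ ?e]) auto
qed

lemma regular_const: "(\<lambda>_. c) \<in> regular_funs N"
  using regular_scale[OF regular_charval[of "\<lambda>_. 0" N], of c]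
  by (simp add: lattice_Z_def charval_zero)

lemma regular_sum:
  "(\<And>x. x \<in> A \<Longrightarrow> f x \<in> regular_funs N) \<Longrightarrow> (\<lambda>t. \<Sum>x\<in>A. f x t) \<in> regular_funs N"
  by (induction A rule: infinite_finite_induct) (simp_all add: regular_const regular_add)

lemma regular_charval_mult:
  assumes "x \<in> lattice_Z N" "f \<in> regular_funs N"
  shows "(\<lambda>t. charval N x t * f t) \<in> regular_funs N"
proof -
  obtain A c where A: "finite A" "A \<subseteq> lattice_Z N"
    "\<forall>t\<in>carrier (torus N). f t = (\<Sum>y\<in>A. c y * charval N y t)"
    using assms unfolding regular_funs_def by blast
  have "(\<lambda>t. \<Sum>y\<in>A. c y * charval N (\<lambda>i. x i + y i) t) \<in> regular_funs N"
    using assms(1) A(2) by (intro regular_sum regular_scale regular_charval) (auto simp: lattice_Z_def)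
  then show ?thesis
    by (rule regular_cong) (use A in \<open>auto simp: charval_add sum_distrib_left ac_simps\<close>)
qed

lemma regular_mult:
  assumes "f \<in> regular_funs N" "g \<in> regular_funs N" shows "(\<lambda>t. f t * g t) \<in> regular_funs N"
proof -
  obtain A c where A: "finite A" "A \<subseteq> lattice_Z N"
    "\<forall>t\<in>carrier (torus N). f t = (\<Sum>y\<in>A. c y * charval N y t)"
    using assms unfolding regular_funs_def by blast
  have "(\<lambda>t. \<Sum>y\<in>A. c y * (charval N y t * g t)) \<in> regular_funs N"
    using assms(2) A(2) by (intro regular_sum regular_scale regular_charval_mult) auto
  then show ?thesis
    by (rule regular_cong) (use A(3) in \<open>simp add: sum_distrib_right mult.assoc\<close>)
qed

lemma regular_prod:
  "(\<And>x. x \<in> A \<Longrightarrow> f x \<in> regular_funs N) \<Longrightarrow> (\<lambda>t. \<Prod>x\<in>A. f x t) \<in> regular_funs N"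
  by (induction A rule: infinite_finite_induct) (simp_all add: regular_const regular_mult)

lemma regular_coord:
  assumes "i \<in> {1..N}" shows "(\<lambda>t. t i) \<in> regular_funs N"
proof -
  have "charval N (\<lambda>j. if j = i then 1 else 0) \<in> regular_funs N"
    using assms by (intro regular_charval) (auto simp: lattice_Z_def)
  moreover have "charval N (\<lambda>j. if j = i then 1 else 0) t = t i" for t
  proof -
    have "charval N (\<lambda>j. if j = i then 1 else 0) t = (\<Prod>j\<in>{1..N}. if j = i then t j else 1)"
      unfolding charval_def by (intro prod.cong) auto
    then show ?thesis using assms by (simp add: prod.delta)
  qed
  ultimately show ?thesis by (auto intro: regular_cong)
qed

text \<open>Both \<open>\<phi>\<close> (with \<open>w\<close> the odd powers of \<open>v\<close>) and the direction subtorus of its image (with \<open>w = 1\<close>)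
  are of this form.\<close>

definition emb :: "nat \<Rightarrow> nat \<Rightarrow> (nat \<Rightarrow> complex) \<Rightarrow> (nat \<Rightarrow> complex) \<Rightarrow> (nat \<Rightarrow> complex)" where
  "emb n k w t = (\<lambda>i\<in>{1..n + k}. if i \<le> n then t i else w i)"

context
  fixes n k :: nat and w :: "nat \<Rightarrow> complex"
  assumes w: "\<And>i. w i \<noteq> 0"
begin

lemma emb_carrier: "t \<in> carrier (torus n) \<Longrightarrow> emb n k w t \<in> carrier (torus (n + k))"
  using w by (auto simp: carrier_torus PiE_iff emb_def)

lemma charval_emb:
  "charval (n + k) x (emb n k w t) =
     (\<Prod>i\<in>{n+1..n+k}. w i powi x i) * charval n (\<lambda>i. if i \<le> n then x i else 0) t"
proof -
  have "{1..n+k} = {n+1..n+k} \<union> {1..n}" by auto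
  then have "charval (n + k) x (emb n k w t) =
    (\<Prod>i\<in>{n+1..n+k}. emb n k w t i powi x i) * (\<Prod>i\<in>{1..n}. emb n k w t i powi x i)"
    unfolding charval_def by (simp only:) (rule prod.union_disjoint, auto)
  also have "\<dots> = (\<Prod>i\<in>{n+1..n+k}. w i powi x i) * charval n (\<lambda>i. if i \<le> n then x i else 0) t"
    unfolding charval_def by (intro arg_cong2[where f = "(*)"] prod.cong) (auto simp: emb_def)
  finally show ?thesis .
qed

lemma variety_morphism_emb: "variety_morphism n (n + k) (emb n k w)"
  unfolding variety_morphism_def
proof (intro conjI ballI)
  show "emb n k w ` carrier (torus n) \<subseteq> carrier (torus (n + k))"
    using emb_carrier by auto
  fix g assume "g \<in> regular_funs (n + k)"
  then obtain A c where A: "finite A" "A \<subseteq> lattice_Z (n+k)"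
    "\<forall>t\<in>carrier (torus (n+k)). g t = (\<Sum>y\<in>A. c y * charval (n+k) y t)"
    unfolding regular_funs_def by blast
  have "(\<lambda>t. \<Sum>y\<in>A. c y * charval (n+k) y (emb n k w t)) \<in> regular_funs n"
    unfolding charval_emb
    using A(2)
    by (intro regular_sum regular_scale regular_charval) (fastforce simp: lattice_Z_def)
  then show "(\<lambda>t. g (emb n k w t)) \<in> regular_funs n"
    by (rule regular_cong) (use A emb_carrier in auto)
qed

text \<open>Characters of the first \<open>n\<close> coordinates extend to the larger torus without changing their values,
  so the embedding is a closed immersion; this gives finiteness with a single generator.\<close>

lemma emb_pullback_surj:
  assumes "f \<in> regular_funs n"
  shows "\<exists>g\<in>regular_funs (n + k). \<forall>t\<in>carrier (torus n). f t = g (emb n k w t)"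
proof -
  obtain A c where A: "finite A" "A \<subseteq> lattice_Z n"
    "\<forall>t\<in>carrier (torus n). f t = (\<Sum>y\<in>A. c y * charval n y t)"
    using assms unfolding regular_funs_def by blast
  let ?g = "\<lambda>s. \<Sum>y\<in>A. c y * charval (n+k) y s"
  have "?g \<in> regular_funs (n + k)"
    using A(2) by (intro regular_sum regular_scale regular_charval) (auto simp: lattice_Z_def)
  moreover have "charval (n+k) y (emb n k w t) = charval n y t" if "y \<in> A" for y t
  proof -
    have y: "y i = 0" if "i > n" for i using A(2) \<open>y \<in> A\<close> that by (auto simp: lattice_Z_def)
    then have "(\<lambda>i. if i \<le> n then y i else 0) = y" by (auto simp: fun_eq_iff)
    moreover have "(\<Prod>i\<in>{n+1..n+k}. w i powi y i) = 1"
      using y by (intro prod.neutral) auto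
    ultimately show ?thesis by (simp add: charval_emb)
  qed
  ultimately show ?thesis using A(3) by (intro bexI[of _ ?g]) auto
qed

lemma finite_morphism_emb: "finite_morphism n (n + k) (emb n k w)"
  unfolding finite_morphism_def
proof (intro conjI variety_morphism_emb exI[of _ "{\<lambda>_. 1}"] ballI)
  fix f assume "f \<in> regular_funs n"
  from emb_pullback_surj[OF this] obtain g where
    "g \<in> regular_funs (n + k)" "\<forall>t\<in>carrier (torus n). f t = g (emb n k w t)" by blast
  then show "\<exists>g. (\<forall>b\<in>{\<lambda>_. 1}. g b \<in> regular_funs (n + k)) \<and>
      (\<forall>t\<in>carrier (torus n). f t = (\<Sum>b\<in>{\<lambda>_. 1}. g b (emb n k w t) * b t))"
    by (intro exI[of _ "\<lambda>_. g"]) auto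
qed (auto simp: regular_const)

lemma emb_hom_based_coset:
  "emb n k w \<in> hom (torus n) (based_coset (torus (n + k)) (emb n k w ` carrier (torus n))
      (emb n k w \<one>\<^bsub>torus n\<^esub>))"
proof (rule homI)
  fix x y assume xy: "x \<in> carrier (torus n)" "y \<in> carrier (torus n)"
  have one: "\<one>\<^bsub>torus n\<^esub> \<in> carrier (torus n)" by (simp add: carrier_torus one_torus)
  show "emb n k w (x \<otimes>\<^bsub>torus n\<^esub> y) = emb n k w x \<otimes>\<^bsub>based_coset (torus (n + k))
      (emb n k w ` carrier (torus n)) (emb n k w \<one>\<^bsub>torus n\<^esub>)\<^esub> emb n k w y"
    unfolding based_coset_def monoid.simps partial_object.simps inv_torus[OF emb_carrier[OF one]]
    using w by (auto simp: mult_torus one_torus emb_def fun_eq_iff)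
qed (auto simp: based_coset_def)

end

lemma subtorus_emb_one: "subtorus_of_dim (n + k) n (emb n k (\<lambda>_. 1) ` carrier (torus n))"
  unfolding subtorus_of_dim_def
proof (intro exI[of _ "emb n k (\<lambda>_. 1)"] conjI ballI refl)
  show "emb n k (\<lambda>_. 1) \<in> hom (torus n) (torus (n + k))"
    by (rule homI) (auto simp: emb_carrier, auto simp: emb_def mult_torus)
qed (auto simp: variety_morphism_emb emb_pullback_surj)

lemma emb_image_coset:
  assumes "\<And>i. w i \<noteq> 0"
  shows "emb n k w ` carrier (torus n) =
    emb n k w \<one>\<^bsub>torus n\<^esub> <#\<^bsub>torus (n + k)\<^esub> (emb n k (\<lambda>_. 1) ` carrier (torus n))"
proof -
  have "emb n k w t = emb n k w \<one>\<^bsub>torus n\<^esub> \<otimes>\<^bsub>torus (n + k)\<^esub> emb n k (\<lambda>_. 1) t" for t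
    by (auto simp: emb_def mult_torus one_torus fun_eq_iff)
  then have "emb n k w ` carrier (torus n) = (\<lambda>t. emb n k w \<one>\<^bsub>torus n\<^esub>
      \<otimes>\<^bsub>torus (n + k)\<^esub> emb n k (\<lambda>_. 1) t) ` carrier (torus n)"
    by (rule image_cong[OF refl])
  then show ?thesis by (auto simp: l_coset_def)
qed

section \<open>Sums and products over the roots\<close>

definition short_root :: "nat \<Rightarrow> int \<Rightarrow> nat \<Rightarrow> int" where
  "short_root i s = (\<lambda>k. if k = i then s else 0)"

definition long_root :: "nat \<Rightarrow> nat \<Rightarrow> int \<Rightarrow> int \<Rightarrow> nat \<Rightarrow> int" where
  "long_root i j s s' = (\<lambda>k. if k = i then s else if k = j then s' else 0)"

lemma short_rootI: "i \<in> {1..N} \<Longrightarrow> s \<in> {1, -1} \<Longrightarrow> short_root i s \<in> short_roots N"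
  unfolding short_roots_def short_root_def by blast

lemma short_rootE:
  assumes "\<alpha> \<in> short_roots N"
  obtains i s where "\<alpha> = short_root i s" "i \<in> {1..N}" "s \<in> {1, -1}"
  using assms unfolding short_roots_def short_root_def by blast

lemma long_rootI:
  "i \<in> {1..N} \<Longrightarrow> j \<in> {1..N} \<Longrightarrow> i < j \<Longrightarrow> s \<in> {1, -1} \<Longrightarrow> s' \<in> {1, -1} \<Longrightarrow>
     long_root i j s s' \<in> long_roots N"
  unfolding long_roots_def long_root_def by blast

lemma long_rootE:
  assumes "\<alpha> \<in> long_roots N"
  obtains i j s s' where "\<alpha> = long_root i j s s'" "i \<in> {1..N}" "j \<in> {1..N}" "i < j"
    "s \<in> {1, -1}" "s' \<in> {1, -1}"
  using assms unfolding long_roots_def long_root_def by blast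

lemma short_roots_image: "short_roots N = (\<lambda>(i, s). short_root i s) ` ({1..N} \<times> {1, -1})"
proof (intro equalityI subsetI)
  fix \<alpha> assume "\<alpha> \<in> short_roots N"
  then obtain i s where "\<alpha> = short_root i s" "i \<in> {1..N}" "s \<in> {1, -1}" by (rule short_rootE)
  then show "\<alpha> \<in> (\<lambda>(i, s). short_root i s) ` ({1..N} \<times> {1, -1})"
    by (intro image_eqI[of _ _ "(i, s)"]) auto
qed (auto intro!: short_rootI)

lemma long_roots_image:
  "long_roots N = (\<lambda>((j, i), (s, s')). long_root i j s s') `
     ((SIGMA j:{1..N}. {1..<j}) \<times> ({1, -1} \<times> {1, -1}))"
proof (intro equalityI subsetI)
  fix \<alpha> assume "\<alpha> \<in> long_roots N"
  then obtain i j s s' where "\<alpha> = long_root i j s s'" "i \<in> {1..N}" "j \<in> {1..N}" "i < j"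
    "s \<in> {1, -1}" "s' \<in> {1, -1}" by (rule long_rootE)
  then show "\<alpha> \<in> (\<lambda>((j, i), (s, s')). long_root i j s s') `
     ((SIGMA j:{1..N}. {1..<j}) \<times> ({1, -1} \<times> {1, -1}))"
    by (intro image_eqI[of _ _ "((j, i), (s, s'))"]) auto
qed (auto intro!: long_rootI)

lemma short_root_eq_iff: "s \<noteq> 0 \<Longrightarrow> short_root i s = short_root i' s' \<longleftrightarrow> i = i' \<and> s = s'"
  unfolding short_root_def fun_eq_iff by (metis (full_types))

lemma long_root_eqD:
  assumes "long_root i j s s' = long_root a b u u'" "i < j" "a < b"
    "s \<noteq> 0" "s' \<noteq> 0" "u \<noteq> 0" "u' \<noteq> 0"
  shows "i = a \<and> j = b \<and> s = u \<and> s' = u'"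
proof -
  have eq: "long_root i j s s' x = long_root a b u u' x" for x using assms(1) by simp
  have "{i, j} = {a, b}"
    using eq assms(4-) by (auto simp: long_root_def split: if_splits) metis+
  then have "i = a" "j = b" using assms(2,3) by (auto simp: doubleton_eq_iff)
  with eq[of i] eq[of j] assms(2) show ?thesis by (auto simp: long_root_def)
qed

lemma short_long_disjoint: "short_roots N \<inter> long_roots N = {}"
proof -
  have "short_root a u \<noteq> long_root i j s s'" if "i < j" "s \<noteq> 0" "s' \<noteq> 0" for a u i j s s'
  proof
    assume "short_root a u = long_root i j s s'"
    then have "short_root a u x = long_root i j s s' x" for x by simp
    from this[of i] this[of j] that show False
      by (auto simp: short_root_def long_root_def split: if_splits)
  qed
  then show ?thesis unfolding short_roots_image long_roots_image by fastforce
qed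

lemma finite_short_roots: "finite (short_roots N)" and finite_long_roots: "finite (long_roots N)"
  and finite_roots_B: "finite (roots_B N)"
  by (auto simp: roots_B_def short_roots_image long_roots_image)

context comm_monoid_set
begin

lemma short_roots: "F g (short_roots N) =
    F (\<lambda>i. g (short_root i 1) \<^bold>* g (short_root i (-1))) {1..N}"
proof -
  have "inj_on (\<lambda>(i, s). short_root i s) ({1..N} \<times> {1, -1})"
    by (auto simp: inj_on_def short_root_eq_iff)
  then have "F g (short_roots N) = F (\<lambda>(i, s). g (short_root i s)) ({1..N} \<times> {1, -1})"
    unfolding short_roots_image by (subst reindex) (auto intro: cong)
  then show ?thesis by (simp add: cartesian_product[symmetric])
qed

lemma long_roots: "F g (long_roots N) =
    F (\<lambda>j. F (\<lambda>i. (g (long_root i j 1 1) \<^bold>* g (long_root i j 1 (-1))) \<^bold>*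
       (g (long_root i j (-1) 1) \<^bold>* g (long_root i j (-1) (-1)))) {1..<j}) {1..N}"
proof -
  have "inj_on (\<lambda>((j, i), (s, s')). long_root i j s s')
      ((SIGMA j:{1..N}. {1..<j}) \<times> ({1, -1} \<times> {1, -1}))"
    by (intro inj_onI) (auto dest!: long_root_eqD)
  then have "F g (long_roots N) = F (\<lambda>((j, i), (s, s')). g (long_root i j s s'))
      ((SIGMA j:{1..N}. {1..<j}) \<times> ({1, -1} \<times> {1, -1}))"
    unfolding long_roots_image by (subst reindex) (auto intro: cong)
  also have "\<dots> = F (\<lambda>(j, i). F (\<lambda>(s, s'). g (long_root i j s s')) ({1, -1} \<times> {1, -1}))
      (SIGMA j:{1..N}. {1..<j})"
    by (subst cartesian_product[symmetric]) (auto intro: cong)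
  also have "\<dots> = F (\<lambda>j. F (\<lambda>i. F (\<lambda>(s, s'). g (long_root i j s s')) ({1, -1} \<times> {1, -1})) {1..<j}) {1..N}"
    by (subst Sigma) auto
  moreover have "F (\<lambda>(s, s'). g (long_root i j s s')) ({1, -1} \<times> {1, -1}) =
      (g (long_root i j 1 1) \<^bold>* g (long_root i j 1 (-1))) \<^bold>*
       (g (long_root i j (-1) 1) \<^bold>* g (long_root i j (-1) (-1)))" for i j
    by (simp add: cartesian_product[symmetric] assoc)
  ultimately show ?thesis by simp
qed

lemma roots_B: "F g (roots_B N) = F g (short_roots N) \<^bold>* F g (long_roots N)"
  unfolding roots_B_def
  by (rule union_disjoint) (simp_all add: finite_short_roots finite_long_roots short_long_disjoint)

end

lemma sum_roots_B_const:
  fixes f :: "(nat \<Rightarrow> int) \<Rightarrow> real"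
  assumes "\<And>\<alpha>. \<alpha> \<in> short_roots N \<Longrightarrow> f \<alpha> = a" "\<And>\<alpha>. \<alpha> \<in> long_roots N \<Longrightarrow> f \<alpha> = b"
  shows "(\<Sum>\<alpha>\<in>roots_B N. f \<alpha>) = 2 * (real N * a + real N * (real N - 1) * b)"
proof -
  have "(\<Sum>\<alpha>\<in>roots_B N. f \<alpha>) = (\<Sum>\<alpha>\<in>short_roots N. a) + (\<Sum>\<alpha>\<in>long_roots N. b)"
    unfolding sum.roots_B using assms by simp
  also have "(\<Sum>\<alpha>\<in>short_roots N. a) = 2 * real N * a"
    unfolding sum.short_roots by simp
  also have "(\<Sum>\<alpha>\<in>long_roots N. b) = (\<Sum>j=1..N. 4 * b * (real j - 1))"
    unfolding sum.long_roots by (intro sum.cong) (auto simp: of_nat_diff algebra_simps)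
  also have "\<dots> = 2 * b * real N * (real N - 1)"
    by (induction N) (auto simp: algebra_simps)
  finally show ?thesis by (simp add: algebra_simps)
qed

lemma uminus_short_root: "- short_root i s = short_root i (- s)"
  by (auto simp: short_root_def)
lemma uminus_long_root: "- long_root i j s s' = long_root i j (- s) (- s')"
  by (auto simp: long_root_def)

lemma uminus_short_roots: "\<alpha> \<in> short_roots N \<Longrightarrow> - \<alpha> \<in> short_roots N"
  by (erule short_rootE) (auto simp: uminus_short_root intro!: short_rootI)

lemma uminus_long_roots: "\<alpha> \<in> long_roots N \<Longrightarrow> - \<alpha> \<in> long_roots N"
  by (erule long_rootE) (auto simp: uminus_long_root intro!: long_rootI)

text \<open>The summand is even, and a system of positive roots contains one root of each pair \<open>\<plusminus>\<alpha>\<close>; so the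
  sum is half of the sum over all roots and does not depend on the choice of the system.\<close>

lemma sum_positive_roots:
  fixes f :: "(nat \<Rightarrow> int) \<Rightarrow> real"
  assumes "positive_roots N P"
    and f: "\<And>\<alpha>. \<alpha> \<in> short_roots N \<Longrightarrow> f \<alpha> = a" "\<And>\<alpha>. \<alpha> \<in> long_roots N \<Longrightarrow> f \<alpha> = b"
  shows "(\<Sum>\<alpha>\<in>P. f \<alpha>) = real N * a + real N * (real N - 1) * b"
proof -
  obtain g :: "nat \<Rightarrow> real" where g: "\<forall>\<alpha>\<in>roots_B N. (\<Sum>i\<in>{1..N}. g i * of_int (\<alpha> i)) \<noteq> 0"
    "P = {\<alpha>\<in>roots_B N. (\<Sum>i\<in>{1..N}. g i * of_int (\<alpha> i)) > 0}"
    using assms(1) unfolding positive_roots_def by blast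
  have neg: "- \<alpha> \<in> roots_B N" if "\<alpha> \<in> roots_B N" for \<alpha>
    using that by (auto simp: roots_B_def uminus_short_roots uminus_long_roots)
  have fneg: "f (- \<alpha>) = f \<alpha>" if "\<alpha> \<in> roots_B N" for \<alpha>
    using that f uminus_short_roots uminus_long_roots unfolding roots_B_def by (metis UnE)
  have 1: "roots_B N = P \<union> uminus ` P"
  proof (intro equalityI subsetI)
    fix \<alpha> assume \<alpha>: "\<alpha> \<in> roots_B N"
    show "\<alpha> \<in> P \<union> uminus ` P"
    proof (cases "\<alpha> \<in> P")
      case False
      with g \<alpha> neg have "- \<alpha> \<in> P" by (force simp: sum_negf)
      then show ?thesis by (intro UnI2 image_eqI[of _ _ "- \<alpha>"]) auto
    qed simp
  next
    fix \<alpha> assume "\<alpha> \<in> P \<union> uminus ` P"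
    then show "\<alpha> \<in> roots_B N" using neg by (auto simp: g(2))
  qed
  have 2: "P \<inter> uminus ` P = {}" by (auto simp: g(2) sum_negf)
  have fin: "finite P" using finite_roots_B 1 by (metis finite_Un)
  have "(\<Sum>\<alpha>\<in>roots_B N. f \<alpha>) = (\<Sum>\<alpha>\<in>P. f \<alpha>) + (\<Sum>\<alpha>\<in>uminus ` P. f \<alpha>)"
    unfolding 1 using fin 2 by (intro sum.union_disjoint) auto
  also have "(\<Sum>\<alpha>\<in>uminus ` P. f \<alpha>) = (\<Sum>\<alpha>\<in>P. f (- \<alpha>))"
    by (subst sum.reindex) (auto simp: inj_on_def fun_eq_iff)
  also have "\<dots> = (\<Sum>\<alpha>\<in>P. f \<alpha>)" using g(2) fneg by (intro sum.cong) auto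
  finally show ?thesis using sum_roots_B_const[of N f a b] f by simp
qed

text \<open>Sorting the roots of \<open>B\<^sub>n\<^sub>+\<^sub>k\<close>: those in the first \<open>n\<close> coordinates, the mixed ones (attached to the short
  roots of the same coordinate \<open>i \<le> n\<close>, with which they will be combined), and those in the last \<open>k\<close>.\<close>

lemma prod_roots_B_add:
  fixes f :: "(nat \<Rightarrow> int) \<Rightarrow> complex"
  defines "S \<equiv> \<lambda>i. f (short_root i 1) * f (short_root i (-1))"
    and "M \<equiv> \<lambda>i j. (f (long_root i j 1 1) * f (long_root i j 1 (-1))) *
       (f (long_root i j (-1) 1) * f (long_root i j (-1) (-1)))"
  shows "(\<Prod>\<alpha>\<in>roots_B (n + k). f \<alpha>) =
    ((\<Prod>i=1..n. S i * (\<Prod>b=1..k. M i (n + b))) * (\<Prod>j=1..n. \<Prod>i=1..<j. M i j)) *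
    (\<Prod>b=1..k. S (n + b) * (\<Prod>a=1..<b. M (n + a) (n + b)))"
proof -
  have split: "(\<Prod>j=1..n+k. g j) = (\<Prod>j=1..n. g j) * (\<Prod>b=1..k. g (n + b))" for g :: "nat \<Rightarrow> complex"
  proof -
    have "(\<Prod>j=1..n+k. g j) = (\<Prod>j=1..n. g j) * (\<Prod>j=n+1..n+k. g j)"
      by (rule prod.ub_add_nat) simp
    also have "(\<Prod>j=n+1..n+k. g j) = (\<Prod>b=1..k. g (n + b))"
      using prod.shift_bounds_cl_nat_ivl[of g 1 n k] by (simp add: add.commute)
    finally show ?thesis .
  qed
  have inner: "(\<Prod>i=1..<n+b. g i) = (\<Prod>i=1..n. g i) * (\<Prod>a=1..<b. g (n + a))"
    if "b \<ge> 1" for g :: "nat \<Rightarrow> complex" and b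
  proof -
    have "(\<Prod>i=1..<n+b. g i) = (\<Prod>i=1..<n+1. g i) * (\<Prod>i=n+1..<n+b. g i)"
      using that by (intro prod.atLeastLessThan_concat[symmetric]) auto
    also have "(\<Prod>i=n+1..<n+b. g i) = (\<Prod>a=1..<b. g (n + a))"
      using prod.shift_bounds_nat_ivl[of g 1 n b] by (simp add: add.commute)
    finally show ?thesis by (simp add: atLeastLessThanSuc_atLeastAtMost)
  qed
  have "(\<Prod>b=1..k. \<Prod>i=1..<n+b. M i (n+b)) =
      (\<Prod>b=1..k. (\<Prod>i=1..n. M i (n+b)) * (\<Prod>a=1..<b. M (n+a) (n+b)))"
    by (intro prod.cong refl inner) auto
  also have "\<dots> = (\<Prod>i=1..n. \<Prod>b=1..k. M i (n+b)) * (\<Prod>b=1..k. \<Prod>a=1..<b. M (n+a) (n+b))"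
    unfolding prod.distrib by (subst prod.swap) simp
  finally have mixed: "(\<Prod>b=1..k. \<Prod>i=1..<n+b. M i (n+b)) = \<dots>" .
  have "(\<Prod>\<alpha>\<in>roots_B (n + k). f \<alpha>) = (\<Prod>i=1..n+k. S i) * (\<Prod>j=1..n+k. \<Prod>i=1..<j. M i j)"
    unfolding prod.roots_B prod.short_roots prod.long_roots S_def M_def ..
  then show ?thesis unfolding split mixed by (simp add: prod.distrib)
qed

section \<open>Telescoping products\<close>

lemma prod_ivl_Suc: "prod g {1..Suc k} = prod g {1..k} * g (Suc k)"
  by simp

text \<open>The numbers \<open>y v\<^sup>e\<close> with \<open>e\<close> odd, \<open>\<bar>e\<bar> < 2k\<close>, form a geometric progression with ratio \<open>v\<^sup>2\<close>, so
  denominator factors cancel numerator factors along the progression. Starting the induction at \<open>k = 0\<close>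
  needs the bound \<open>2k + 1\<close> in the hypothesis.\<close>

lemma mixed_telescope:
  fixes V y :: "'a::field"
  assumes V: "V \<noteq> 0" and y: "\<And>j. \<bar>j\<bar> \<le> 2 * int k + 1 \<Longrightarrow> odd j \<Longrightarrow> y * V powi j \<noteq> 1"
  shows "(\<Prod>b=1..k. (1 - y * V powi (2 * int b - 1)) / (1 - V powi (-2) * (y * V powi (2 * int b - 1))) *
     ((1 - y * V powi (1 - 2 * int b)) / (1 - V powi (-2) * (y * V powi (1 - 2 * int b))))) =
    (1 - y * V powi (2 * int k - 1)) / (1 - y * V powi (- 2 * int k - 1))"
  using y
proof (induction k)
  case 0
  then show ?case using 0[of "-1"] by simp
next
  case (Suc k)
  have IH: "(\<Prod>b=1..k. (1 - y * V powi (2 * int b - 1)) / (1 - V powi (-2) * (y * V powi (2 * int b - 1))) *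
     ((1 - y * V powi (1 - 2 * int b)) / (1 - V powi (-2) * (y * V powi (1 - 2 * int b))))) =
    (1 - y * V powi (2 * int k - 1)) / (1 - y * V powi (- 2 * int k - 1))"
    by (rule Suc.IH) (use Suc.prems in auto)
  have s: "V powi (-2) * (y * V powi j) = y * V powi (j - 2)" for j
    using V by (simp add: power_int_diff power_int_minus field_simps)
  have e: "2 * int (Suc k) - 1 - 2 = 2 * int k - 1" "1 - 2 * int (Suc k) = - 2 * int k - 1"
    "- 2 * int k - 1 - 2 = - 2 * int (Suc k) - 1" by auto
  have nz: "1 - y * V powi (2 * int k - 1) \<noteq> 0" "1 - y * V powi (- 2 * int k - 1) \<noteq> 0"
    using Suc.prems[of "2 * int k - 1"] Suc.prems[of "- 2 * int k - 1"] by auto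
  have cancel: "A / B * (X / A * (B / Z)) = X / Z" if "A \<noteq> 0" "B \<noteq> 0" for A B X Z :: 'a
    using that by simp
  show ?case
    unfolding prod_ivl_Suc IH unfolding s e by (rule cancel[OF nz])
qed

text \<open>Regularisation deletes the vanishing factors of a product of terms \<open>1 - x\<close>, that is, it replaces
  them by \<open>1\<close>.\<close>

definition unit_guard :: "'a::field \<Rightarrow> 'a" where
  "unit_guard x = (if x = 1 then 1 else 1 - x)"

text \<open>The contribution of a pair of opposite constant long roots with values \<open>q\<^sup>\<plusminus>\<^sup>d\<close>. The guard matters
  for \<open>d = 1\<close>, where one of these values is a pole.\<close>

definition qstep :: "'a::field \<Rightarrow> nat \<Rightarrow> 'a" where
  "qstep q d = (1 - q ^ d) * (1 - inverse q ^ d) / (unit_guard (q ^ (d - 1)) * (1 - inverse q ^ (d + 1)))"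

context
  fixes q :: "'a::field"
  assumes q0: "q \<noteq> 0" and q: "\<And>m. m \<ge> 1 \<Longrightarrow> q ^ m \<noteq> 1"
begin

text \<open>For \<open>d > 1\<close>, \<open>qstep q d\<close> equals \<open>q [d]\<^sup>2 / ([d-1] [d+1])\<close> with \<open>[d] = 1 - q\<^sup>d\<close>: a second multiplicative difference, so
  only boundary terms remain.\<close>

lemma prod_qstep: "(\<Prod>d=1..m. qstep q d) = q ^ m * (1 - q) * unit_guard (q ^ m) / (1 - q ^ (m + 1))"
proof (induction m)
  case 0
  then show ?case using q[of 1] by (simp add: unit_guard_def)
next
  case (Suc m)
  have nz: "1 - q ^ Suc m \<noteq> 0" "1 - q ^ Suc (Suc m) \<noteq> 0" "unit_guard (q ^ m) \<noteq> 0"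
    using q[of "Suc m"] q[of "Suc (Suc m)"] by (auto simp: unit_guard_def)
  have inv: "1 - inverse q ^ d = - (1 - q ^ d) / q ^ d" for d
    using q0 by (simp add: field_simps)
  have g: "unit_guard (q ^ Suc m) = 1 - q ^ Suc m" using q[of "Suc m"] by (simp add: unit_guard_def)
  have "qstep q (Suc m) = q * (1 - q ^ Suc m) ^ 2 / (unit_guard (q ^ m) * (1 - q ^ Suc (Suc m)))"
    unfolding qstep_def inv using q0 nz by (simp add: field_simps power2_eq_square)
  then show ?case
    unfolding prod_ivl_Suc Suc.IH g using nz by (simp add: power2_eq_square)
qed

text \<open>In the step from \<open>k\<close> to \<open>k + 1\<close> the new long roots cancel the numerator \<open>[2k+1]\<close> of the new short
  roots, and what is left of them cancels the two new denominators up to a monomial times \<open>q - 1\<close>: for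
  \<open>k > 0\<close> the sign of \<open>1 - q\<close> is reversed by \<open>[2k] / (1 - q\<^sup>-\<^sup>2\<^sup>k) = - q\<^sup>2\<^sup>k\<close>, whereas for \<open>k = 0\<close> both terms of
  this quotient are guarded and equal to \<open>1\<close>, which is the origin of the sign.\<close>

lemma constant_telescope:
  "(\<Prod>b=1..k. (1 - q ^ (2 * b - 1)) * (1 - inverse q ^ (2 * b - 1))) *
      (\<Prod>b=1..k. \<Prod>d=1..2 * b - 2. qstep q d) =
    (if k = 0 then 1 else -1) * (q ^ (2 * k * (k - 1)) * (q - 1) ^ k) *
      (\<Prod>d<2 * k. unit_guard (inverse q ^ d))"
proof (induction k)
  case 0 then show ?case by simp
next
  case (Suc k)
  have inv: "1 - inverse q ^ d = - (1 - q ^ d) / q ^ d" for d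
    using q0 by (simp add: field_simps)
  have g: "unit_guard (inverse q ^ d) = - (1 - q ^ d) / q ^ d" if "d \<ge> 1" for d
    using q[OF that] unfolding inv[symmetric] by (simp add: unit_guard_def power_inverse)
  show ?case
  proof (cases k)
    case 0
    then show ?thesis using g[of 1] q[of 1] q0
      by (simp add: unit_guard_def inv numeral_2_eq_2 lessThan_Suc field_simps)
  next
    case (Suc k')
    then have "k \<noteq> 0" by simp
    have nz: "1 - q ^ (2 * k) \<noteq> 0" "1 - q ^ (2 * k + 1) \<noteq> 0"
      using q[of "2 * k"] q[of "2 * k + 1"] Suc by auto
    let ?A = "(\<Prod>b=1..k. (1 - q ^ (2 * b - 1)) * (1 - inverse q ^ (2 * b - 1)))"
    let ?B = "\<Prod>b=1..k. \<Prod>d=1..2 * b - 2. qstep q d"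
    let ?C = "\<Prod>d<2 * k. unit_guard (inverse q ^ d)"
    have step: "((1 - q ^ (2 * k + 1)) * (1 - inverse q ^ (2 * k + 1))) *
        (q ^ (2 * k) * (1 - q) * unit_guard (q ^ (2 * k)) / (1 - q ^ (2 * k + 1))) =
        q ^ (4 * k) * (q - 1) * (unit_guard (inverse q ^ (2 * k)) * unit_guard (inverse q ^ (2 * k + 1)))"
    proof -
      have 1: "unit_guard (q ^ (2 * k)) = 1 - q ^ (2 * k)" using nz by (simp add: unit_guard_def)
      have 2: "q ^ (4 * k) = q ^ (2 * k) * q ^ (2 * k)" by (simp add: power_add[symmetric])
      have 3: "unit_guard (inverse q ^ (2 * k)) = - (1 - q ^ (2 * k)) / q ^ (2 * k)"
        using g[of "2 * k"] Suc by simp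
      have 4: "unit_guard (inverse q ^ (2 * k + 1)) = 1 - inverse q ^ (2 * k + 1)"
        using g[of "2 * k + 1"] unfolding inv[symmetric] by simp
      have alg: "(X * Y) * (c * (1 - q) * U / X) = c * c * (q - 1) * (- U / c * Y)"
        if "X \<noteq> 0" "c \<noteq> 0" for X Y U c :: 'a using that by (simp add: field_simps)
      show ?thesis unfolding 1 2 3 4 by (rule alg) (use nz q0 in auto)
    qed
    have e: "2 * Suc k - 1 = 2 * k + 1" "2 * Suc k - 2 = 2 * k" "2 * Suc k = Suc (Suc (2 * k))" by auto
    have "2 * Suc k * (Suc k - 1) = 2 * k * (k - 1) + 4 * k"
      by (cases k) (auto simp: algebra_simps)
    then have pw: "q ^ (2 * Suc k * (Suc k - 1)) = q ^ (2 * k * (k - 1)) * q ^ (4 * k)"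
      by (simp only: power_add)
    have "(\<Prod>b=1..Suc k. (1 - q ^ (2 * b - 1)) * (1 - inverse q ^ (2 * b - 1))) *
        (\<Prod>b=1..Suc k. \<Prod>d=1..2 * b - 2. qstep q d) =
        (?A * ?B) * (((1 - q ^ (2 * k + 1)) * (1 - inverse q ^ (2 * k + 1))) * (\<Prod>d=1..2 * k. qstep q d))"
      unfolding prod_ivl_Suc e by simp
    also have "\<dots> = (- (q ^ (2 * k * (k - 1)) * (q - 1) ^ k) * ?C) * (q ^ (4 * k) * (q - 1) *
        (unit_guard (inverse q ^ (2 * k)) * unit_guard (inverse q ^ (2 * k + 1))))"
      unfolding Suc.IH prod_qstep[of "2 * k"] step using \<open>k \<noteq> 0\<close> by simp
    also have "\<dots> = (if Suc k = 0 then 1 else -1) *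
        (q ^ (2 * Suc k * (Suc k - 1)) * (q - 1) ^ Suc k) *
        (\<Prod>d<2 * Suc k. unit_guard (inverse q ^ d))"
      unfolding pw unfolding e(3) prod.lessThan_Suc by simp
    finally show ?thesis .
  qed
qed

end

text \<open>For the long roots in the last coordinates: with larger index \<open>b\<close> fixed, the exponents \<open>b - a\<close> and
  \<open>a + b - 1\<close> exhaust \<open>1, \<dots>, 2b - 2\<close>.\<close>

lemma prod_differences_sums:
  fixes f :: "nat \<Rightarrow> 'a::comm_monoid_mult"
  shows "(\<Prod>a=1..<b. f (b - a) * f (a + b - 1)) = (\<Prod>d=1..2 * b - 2. f d)"
proof (cases b)
  case (Suc m)
  have "(\<Prod>a=1..m. f (Suc m - a) * f (a + m)) = (\<Prod>d=1..2 * m. f d)"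
  proof -
    have "(\<Prod>a=1..m. f (Suc m - a)) = (\<Prod>d=1..m. f d)"
      using prod.atLeastAtMost_rev[of f 1 m] by simp
    moreover have "(\<Prod>a=1..m. f (a + m)) = (\<Prod>d=m+1..m+m. f d)"
      using prod.shift_bounds_cl_nat_ivl[of f 1 m m] by (simp add: add.commute)
    moreover have "(\<Prod>d=1..m+m. f d) = (\<Prod>d=1..m. f d) * (\<Prod>d=m+1..m+m. f d)"
      by (rule prod.ub_add_nat) simp
    ultimately show ?thesis by (simp add: prod.distrib mult_2)
  qed
  then show ?thesis using Suc by (simp add: atLeastLessThanSuc_atLeastAtMost)
qed simp

text \<open>For the short roots in the last coordinates: the denominators have the exponents \<open>k - b\<close> and
  \<open>k + b - 1\<close>.\<close>

lemma prod_opposite_pairs: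
  fixes f :: "nat \<Rightarrow> 'a::comm_monoid_mult"
  shows "(\<Prod>b=1..k. f (k - b) * f (k + b - 1)) = (\<Prod>d<2 * k. f d)"
proof -
  have "(\<Prod>b=1..k. f (k - b)) = (\<Prod>d<k. f d)"
    by (rule prod.reindex_bij_witness[of _ "\<lambda>d. k - d" "\<lambda>b. k - b"]) auto
  moreover have "(\<Prod>b=1..k. f (k + b - 1)) = (\<Prod>d=k..<2*k. f d)"
    by (rule prod.reindex_bij_witness[of _ "\<lambda>d. d + 1 - k" "\<lambda>b. k + b - 1"]) auto
  moreover have "(\<Prod>d<2*k. f d) = (\<Prod>d<k. f d) * (\<Prod>d=k..<2*k. f d)"
    using prod.atLeastLessThan_concat[of 0 k "2*k" f] by (simp add: atLeast0LessThan)
  ultimately show ?thesis by (simp add: prod.distrib)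
qed

text \<open>The factor of the \<open>\<mu>\<close>-function at a root with inverse value \<open>y\<close>; \<open>P\<close> and \<open>Q\<close> stand for
  \<open>v\<close> to the power \<open>-2m\<^sub>+(\<alpha>)\<close> and \<open>-2m\<^sub>-(\<alpha>)\<close>.\<close>

definition root_fac :: "'a::field \<Rightarrow> 'a \<Rightarrow> 'a \<Rightarrow> 'a" where
  "root_fac P Q y = (1 - y ^ 2) / ((1 + Q * y) * (1 - P * y))"

definition root_fac_reg :: "'a::field \<Rightarrow> 'a \<Rightarrow> 'a \<Rightarrow> 'a" where
  "root_fac_reg P Q y = (1 - y ^ 2) / ((1 + Q * y) * unit_guard (P * y))"

lemma root_fac_one: "1 + y \<noteq> 0 \<Longrightarrow> root_fac P 1 y = (1 - y) / (1 - P * y)"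
proof -
  assume "1 + y \<noteq> 0"
  moreover have "1 - y ^ 2 = (1 + y) * (1 - y)" by (simp add: power2_eq_square algebra_simps)
  ultimately show ?thesis by (simp add: root_fac_def)
qed

lemma root_fac_reg_one: "1 + y \<noteq> 0 \<Longrightarrow> root_fac_reg P 1 y = (1 - y) / unit_guard (P * y)"
proof -
  assume "1 + y \<noteq> 0"
  moreover have "1 - y ^ 2 = (1 + y) * (1 - y)" by (simp add: power2_eq_square algebra_simps)
  ultimately show ?thesis by (simp add: root_fac_reg_def)
qed

text \<open>By telescoping, the mixed roots of one coordinate \<open>t\<close> leave \<open>(1 - y v\<^sup>2\<^sup>k\<^sup>-\<^sup>1) / (1 - y v\<^sup>-\<^sup>2\<^sup>k\<^sup>-\<^sup>1)\<close> for
  \<open>y = t\<^sup>\<plusminus>\<^sup>1\<close>. The numerators are, up to a power of \<open>v\<close>, the short denominators for \<open>m\<^sub>+ - 1\<close>, and the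
  denominators are those for \<open>m\<^sub>+\<close>.\<close>

lemma mixed_factors:
  fixes V t Q :: "'a::field"
  assumes V: "V \<noteq> 0" and t0: "t \<noteq> 0"
    and t: "\<And>j. \<bar>j\<bar> \<le> 2 * int k + 1 \<Longrightarrow> odd j \<Longrightarrow> t \<noteq> V powi j \<and> t \<noteq> - (V powi j)"
  shows "(root_fac (V powi (1 - 2 * int k)) Q (inverse t) * root_fac (V powi (1 - 2 * int k)) Q t) *
      (\<Prod>b=1..k.
        (root_fac (V powi (-2)) 1 (inverse t * V powi (1 - 2 * int b)) *
         root_fac (V powi (-2)) 1 (inverse t * V powi (2 * int b - 1))) *
        (root_fac (V powi (-2)) 1 (t * V powi (1 - 2 * int b)) *
         root_fac (V powi (-2)) 1 (t * V powi (2 * int b - 1)))) =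
    V powi (4 * int k - 2) *
      (root_fac (V powi (- 2 * int k - 1)) Q (inverse t) * root_fac (V powi (- 2 * int k - 1)) Q t)"
proof -
  have inv: "V powi (- j) = inverse (V powi j)" for j by (rule power_int_minus)
  have ne: "y * V powi j \<noteq> 1 \<and> y * V powi j \<noteq> -1"
    if "\<bar>j\<bar> \<le> 2 * int k + 1" "odd j" "y = t \<or> y = inverse t" for y j
  proof -
    have "t \<noteq> V powi j \<and> t \<noteq> - (V powi j)" "t \<noteq> V powi (- j) \<and> t \<noteq> - (V powi (- j))"
      using t[of j] t[of "- j"] that by auto
    moreover have "t = W" if "inverse t * W = 1" for W using that t0 by (simp add: field_simps)
    moreover have "t = inverse W" if "t * W = 1" for W
      using inverse_unique[of W t] that by (simp add: mult.commute)
    ultimately have "y * V powi j \<noteq> 1" "y * - (V powi j) \<noteq> 1"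
      using that(3) unfolding inv inverse_minus_eq[symmetric] by blast+
    then show ?thesis by (metis minus_mult_right minus_minus)
  qed
  have tele: "(\<Prod>b=1..k. root_fac (V powi (-2)) 1 (y * V powi (1 - 2 * int b)) *
         root_fac (V powi (-2)) 1 (y * V powi (2 * int b - 1))) =
      (1 - y * V powi (2 * int k - 1)) / (1 - y * V powi (- 2 * int k - 1))"
    if y: "y = t \<or> y = inverse t" for y
  proof -
    have "(\<Prod>b=1..k. root_fac (V powi (-2)) 1 (y * V powi (1 - 2 * int b)) *
         root_fac (V powi (-2)) 1 (y * V powi (2 * int b - 1))) =
      (\<Prod>b=1..k. (1 - y * V powi (2 * int b - 1)) / (1 - V powi (-2) * (y * V powi (2 * int b - 1))) *
     ((1 - y * V powi (1 - 2 * int b)) / (1 - V powi (-2) * (y * V powi (1 - 2 * int b)))))"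
    proof (intro prod.cong refl)
      fix b assume b: "b \<in> {1..k}"
      have n: "1 + y * V powi (1 - 2 * int b) \<noteq> 0" "1 + y * V powi (2 * int b - 1) \<noteq> 0"
        using ne[of "1 - 2 * int b" y] ne[of "2 * int b - 1" y] y b by (auto simp: add_eq_0_iff)
      show "root_fac (V powi (-2)) 1 (y * V powi (1 - 2 * int b)) *
         root_fac (V powi (-2)) 1 (y * V powi (2 * int b - 1)) =
        (1 - y * V powi (2 * int b - 1)) / (1 - V powi (-2) * (y * V powi (2 * int b - 1))) *
        ((1 - y * V powi (1 - 2 * int b)) / (1 - V powi (-2) * (y * V powi (1 - 2 * int b))))"
        unfolding n[THEN root_fac_one] by (rule mult.commute)
    qed
    also have "\<dots> = (1 - y * V powi (2 * int k - 1)) / (1 - y * V powi (- 2 * int k - 1))"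
      by (rule mixed_telescope[OF V]) (use ne y in blast)
    finally show ?thesis .
  qed
  define Z where "Z = V powi (2 * int k - 1)"
  have Z0: "Z \<noteq> 0" using V by (simp add: Z_def)
  have P': "V powi (1 - 2 * int k) = inverse Z" unfolding Z_def inv[symmetric] by simp
  have ZZ: "V powi (4 * int k - 2) = Z * Z"
    unfolding Z_def using V by (simp add: power_int_add[symmetric])
  define P where "P = V powi (- 2 * int k - 1)"
  have nz: "1 - inverse Z * t \<noteq> 0" "1 - inverse Z * inverse t \<noteq> 0"
    using ne[of "1 - 2 * int k" t] ne[of "1 - 2 * int k" "inverse t"]
    unfolding P' by (auto simp: mult.commute)
  have flip: "(1 - inverse t * Z) * (1 - t * Z) = Z * Z * ((1 - inverse Z * inverse t) * (1 - inverse Z * t))"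
    using Z0 t0 by (simp add: field_simps)
  have alg: "(a / (b * c) * (a' / (b' * c'))) * (x / d * (x' / d')) = z * (a / (b * d) * (a' / (b' * d')))"
    if "x * x' = z * (c * c')" "c \<noteq> 0" "c' \<noteq> 0" for a b c a' b' c' x x' d d' z :: 'a
  proof -
    have "(a / (b * c) * (a' / (b' * c'))) * (x / d * (x' / d')) =
        (x * x') / (c * c') * (a / (b * d) * (a' / (b' * d')))" by (simp add: ac_simps)
    then show ?thesis unfolding that(1) using that(2,3) by simp
  qed
  show ?thesis
    unfolding prod.distrib tele[OF disjI1[OF refl], unfolded prod.distrib]
      tele[OF disjI2[OF refl], unfolded prod.distrib] P' ZZ Z_def[symmetric] P_def[symmetric]
    unfolding root_fac_def mult.commute[of _ P]
    by (rule alg[OF flip nz(2) nz(1)])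
qed

text \<open>Collecting all roots constant on the image, with poles deleted. In the order of the statement the
  inverse values of the four long roots in directions \<open>a < b\<close> are \<open>q\<close> to the powers \<open>1 - a - b\<close>,
  \<open>b - a\<close>, \<open>a - b\<close>, \<open>a + b - 1\<close>, which pair up to two values of \<open>qstep\<close>.\<close>

lemma constant_factors:
  fixes v :: real and Q :: complex and k :: nat
  defines "V \<equiv> complex_of_real v"
  assumes v: "v > 1"
  shows "(\<Prod>b=1..k.
      (root_fac_reg (V powi (1 - 2 * int k)) Q (V powi (1 - 2 * int b)) *
       root_fac_reg (V powi (1 - 2 * int k)) Q (V powi (2 * int b - 1))) *
      (\<Prod>a=1..<b.
        (root_fac_reg (V powi (-2)) 1 (V powi (1 - 2 * int a) * V powi (1 - 2 * int b)) *
         root_fac_reg (V powi (-2)) 1 (V powi (1 - 2 * int a) * V powi (2 * int b - 1))) *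
        (root_fac_reg (V powi (-2)) 1 (V powi (2 * int a - 1) * V powi (1 - 2 * int b)) *
         root_fac_reg (V powi (-2)) 1 (V powi (2 * int a - 1) * V powi (2 * int b - 1))))) =
    (if k = 0 then 1 else -1) * (V ^ (4 * k * (k - 1)) * (V ^ 2 - 1) ^ k) /
      (\<Prod>b=1..k. (1 + Q * V powi (1 - 2 * int b)) * (1 + Q * V powi (2 * int b - 1)))"
proof -
  have V: "V \<noteq> 0" using v by (simp add: V_def)
  define q where "q = V ^ 2"
  have q0: "q \<noteq> 0" using V by (simp add: q_def)
  have qv: "q = complex_of_real (v ^ 2)" by (simp add: q_def V_def)
  have q1: "q ^ m \<noteq> 1" if "m \<ge> 1" for m
  proof -
    have "(v ^ 2) ^ m > 1" using v that by (intro one_less_power) auto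
    then show ?thesis unfolding qv of_real_power[symmetric] by (metis of_real_eq_1_iff less_irrefl)
  qed
  have qp: "1 + q ^ m \<noteq> 0" "1 + inverse q ^ m \<noteq> 0" for m
  proof -
    have "1 + (v ^ 2) ^ m > 0" "1 + inverse (v ^ 2) ^ m > 0" by (auto intro!: add_pos_nonneg)
    moreover have "1 + q ^ m = complex_of_real (1 + (v ^ 2) ^ m)"
      "1 + inverse q ^ m = complex_of_real (1 + inverse (v ^ 2) ^ m)" by (simp_all add: qv)
    ultimately show "1 + q ^ m \<noteq> 0" "1 + inverse q ^ m \<noteq> 0" by (metis of_real_eq_0_iff less_irrefl)+
  qed
  have ug: "unit_guard (inverse q ^ m) = 1 - inverse q ^ m" if "m \<ge> 1" for m
    using q1[OF that] by (simp add: unit_guard_def power_inverse)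
  have ug0: "unit_guard (inverse q ^ m) \<noteq> 0" for m
    by (simp add: unit_guard_def)
  have qpow: "V powi (2 * int m) = q ^ m" for m
    unfolding q_def by (simp add: power_int_mult)
  have qneg: "V powi (- 2 * int m) = inverse q ^ m" for m
    using qpow[of m] by (simp add: power_int_minus power_inverse)
  have long: "(root_fac_reg (V powi (-2)) 1 (V powi (1 - 2 * int a) * V powi (1 - 2 * int b)) *
         root_fac_reg (V powi (-2)) 1 (V powi (1 - 2 * int a) * V powi (2 * int b - 1))) *
        (root_fac_reg (V powi (-2)) 1 (V powi (2 * int a - 1) * V powi (1 - 2 * int b)) *
         root_fac_reg (V powi (-2)) 1 (V powi (2 * int a - 1) * V powi (2 * int b - 1))) =
      qstep q (b - a) * qstep q (a + b - 1)" if ab: "a \<in> {1..<b}" for a b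
  proof -
    have e: "V powi (1 - 2 * int a) * V powi (1 - 2 * int b) = inverse q ^ (a + b - 1)"
      "V powi (1 - 2 * int a) * V powi (2 * int b - 1) = q ^ (b - a)"
      "V powi (2 * int a - 1) * V powi (1 - 2 * int b) = inverse q ^ (b - a)"
      "V powi (2 * int a - 1) * V powi (2 * int b - 1) = q ^ (a + b - 1)"
      unfolding qpow[symmetric] qneg[symmetric] using ab V
      by (auto simp: power_int_add[symmetric] of_nat_diff algebra_simps)
    have pq: "V powi (-2) * q ^ d = q ^ (d - 1)" "V powi (-2) * inverse q ^ d = inverse q ^ (d + 1)"
      if "d \<ge> 1" for d
    proof -
      have "q ^ d = q * q ^ (d - 1)" using that by (metis power_eq_if not_one_le_zero)
      then show "V powi (-2) * q ^ d = q ^ (d - 1)" "V powi (-2) * inverse q ^ d = inverse q ^ (d + 1)"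
        using qneg[of 1] q0 by simp_all
    qed
    have pair: "root_fac_reg (V powi (-2)) 1 (q ^ d) * root_fac_reg (V powi (-2)) 1 (inverse q ^ d) = qstep q d"
      if "d \<ge> 1" for d
      unfolding root_fac_reg_one[OF qp(1)] root_fac_reg_one[OF qp(2)] pq[OF that] qstep_def
      using ug[of "d + 1"] by simp
    have "b - a \<ge> 1" "a + b - 1 \<ge> 1" using ab by auto
    from this[THEN pair] show ?thesis unfolding e by (simp only: ac_simps)
  qed
  have short: "root_fac_reg (V powi (1 - 2 * int k)) Q (V powi (1 - 2 * int b)) *
       root_fac_reg (V powi (1 - 2 * int k)) Q (V powi (2 * int b - 1)) =
      ((1 - q ^ (2 * b - 1)) * (1 - inverse q ^ (2 * b - 1))) /
       (((1 + Q * V powi (1 - 2 * int b)) * (1 + Q * V powi (2 * int b - 1))) *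
        (unit_guard (inverse q ^ (k - b)) * unit_guard (inverse q ^ (k + b - 1))))"
    if b: "b \<in> {1..k}" for b
  proof -
    have e: "V powi (1 - 2 * int k) * V powi (1 - 2 * int b) = inverse q ^ (k + b - 1)"
      "V powi (1 - 2 * int k) * V powi (2 * int b - 1) = inverse q ^ (k - b)"
      "(V powi (1 - 2 * int b)) ^ 2 = inverse q ^ (2 * b - 1)"
      "(V powi (2 * int b - 1)) ^ 2 = q ^ (2 * b - 1)"
      unfolding qpow[symmetric] qneg[symmetric] power2_eq_square using b V
      by (auto simp: power_int_add[symmetric] of_nat_diff algebra_simps)
    show ?thesis unfolding root_fac_reg_def e by (simp add: ac_simps)
  qed
  let ?D = "\<Prod>b=1..k. (1 + Q * V powi (1 - 2 * int b)) * (1 + Q * V powi (2 * int b - 1))"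
  let ?U = "\<Prod>d<2 * k. unit_guard (inverse q ^ d)"
  let ?N = "\<Prod>b=1..k. (1 - q ^ (2 * b - 1)) * (1 - inverse q ^ (2 * b - 1))"
  have "(\<Prod>b=1..k.
      (root_fac_reg (V powi (1 - 2 * int k)) Q (V powi (1 - 2 * int b)) *
       root_fac_reg (V powi (1 - 2 * int k)) Q (V powi (2 * int b - 1))) *
      (\<Prod>a=1..<b.
        (root_fac_reg (V powi (-2)) 1 (V powi (1 - 2 * int a) * V powi (1 - 2 * int b)) *
         root_fac_reg (V powi (-2)) 1 (V powi (1 - 2 * int a) * V powi (2 * int b - 1))) *
        (root_fac_reg (V powi (-2)) 1 (V powi (2 * int a - 1) * V powi (1 - 2 * int b)) *
         root_fac_reg (V powi (-2)) 1 (V powi (2 * int a - 1) * V powi (2 * int b - 1))))) =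
     (\<Prod>b=1..k. ((1 - q ^ (2 * b - 1)) * (1 - inverse q ^ (2 * b - 1))) /
       (((1 + Q * V powi (1 - 2 * int b)) * (1 + Q * V powi (2 * int b - 1))) *
        (unit_guard (inverse q ^ (k - b)) * unit_guard (inverse q ^ (k + b - 1)))) *
      (\<Prod>a=1..<b. qstep q (b - a) * qstep q (a + b - 1)))"
    by (rule prod.cong[OF refl arg_cong2[where f = "(*)", OF short prod.cong[OF refl long]]])
  also have "\<dots> = ?N / (?D * ?U) * (\<Prod>b=1..k. \<Prod>d=1..2 * b - 2. qstep q d)"
    unfolding prod_differences_sums unfolding prod_opposite_pairs[symmetric] prod.distrib prod_dividef ..
  also have "\<dots> = ?N * (\<Prod>b=1..k. \<Prod>d=1..2 * b - 2. qstep q d) / (?D * ?U)" by simp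
  also have "\<dots> = (if k = 0 then 1 else -1) * (q ^ (2 * k * (k - 1)) * (q - 1) ^ k) * ?U / (?D * ?U)"
    by (rule arg_cong2[where f = "(/)", OF constant_telescope refl]) (use q0 q1 in auto)
  also have "\<dots> = (if k = 0 then 1 else -1) * (q ^ (2 * k * (k - 1)) * (q - 1) ^ k) / ?D"
    using ug0 by (simp add: prod_zero_iff)
  also have "q ^ (2 * k * (k - 1)) = V ^ (4 * k * (k - 1))"
    unfolding q_def power_mult[symmetric] by (simp add: mult.assoc)
  finally show ?thesis unfolding q_def .
qed

section \<open>The normalisation factor\<close>

text \<open>With \<open>g(x) = half_sech v x\<close> one has \<open>g(x) = 1 / (v\<^sup>x + v\<^sup>-\<^sup>x)\<close>, half the hyperbolic secant of \<open>x ln v\<close>; in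
  particular \<open>g\<close> is even. The form below is the one in which it occurs in the normalisation factor.\<close>

definition half_sech :: "real \<Rightarrow> real \<Rightarrow> real" where
  "half_sech v x = v powr x / (1 + (v ^ 2) powr x)"

lemma half_sech_eq: "v > 1 \<Longrightarrow> half_sech v x = 1 / (v powr x + v powr (- x))"
proof -
  assume v: "v > 1"
  have "(v ^ 2) powr x = v powr x * v powr x"
    using v by (simp add: power2_eq_square powr_mult)
  then show ?thesis using v by (simp add: half_sech_def powr_minus divide_simps)
qed

lemma half_sech_minus: "v > 1 \<Longrightarrow> half_sech v (- x) = half_sech v x"
  by (simp add: half_sech_eq add.commute)

lemma half_sech_zero: "v > 1 \<Longrightarrow> half_sech v 0 = 1/2"
  by (simp add: half_sech_eq)

lemma half_sech_pos: "v > 1 \<Longrightarrow> half_sech v x > 0"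
  by (simp add: half_sech_eq add_pos_pos)

text \<open>A discrete Barnes function: it relates to the products of \<open>half_sech\<close> over an initial segment as these
  relate to \<open>half_sech\<close> itself. The normalisation factor contains its values at \<open>\<bar>m\<^sub>- \<plusminus> m\<^sub>+\<bar>\<close>.\<close>

definition barnes :: "real \<Rightarrow> nat \<Rightarrow> real" where
  "barnes v m = (\<Prod>i=1..m. half_sech v (real m - real i) ^ i)"

lemma barnes_pos: "v > 1 \<Longrightarrow> barnes v m > 0"
  by (simp add: barnes_def prod_pos half_sech_pos)

lemma barnes_Suc: "barnes v (Suc m) = barnes v m * (\<Prod>j\<le>m. half_sech v (real j))"
proof -
  have b: "barnes v m = (\<Prod>j<m. half_sech v (real j) ^ (m - j))" for m
    unfolding barnes_def
    by (rule prod.reindex_bij_witness[of _ "\<lambda>d. m - d" "\<lambda>b. m - b"]) (auto simp: of_nat_diff)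
  have "barnes v (Suc m) = (\<Prod>j\<le>m. half_sech v (real j) ^ (m - j) * half_sech v (real j))"
    unfolding b lessThan_Suc_atMost by (intro prod.cong) (auto simp: Suc_diff_le)
  also have "\<dots> = (\<Prod>j\<le>m. half_sech v (real j) ^ (m - j)) * (\<Prod>j\<le>m. half_sech v (real j))"
    by (rule prod.distrib)
  also have "(\<Prod>j\<le>m. half_sech v (real j) ^ (m - j)) = barnes v m"
    unfolding b by (simp add: lessThan_Suc_atMost[symmetric])
  finally show ?thesis .
qed

text \<open>The difference quotient of the even extension of \<open>barnes\<close> to the integers. Passing from \<open>m\<^sub>+\<close> to
  \<open>m\<^sub>+ - 1\<close> moves both arguments \<open>m\<^sub>- \<plusminus> m\<^sub>+\<close> by one, so it changes the Barnes part of \<open>d\<close> by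
  two such quotients.\<close>

definition barnes_ratio :: "real \<Rightarrow> int \<Rightarrow> real" where
  "barnes_ratio v x = barnes v (nat \<bar>x + 1\<bar>) / barnes v (nat \<bar>x\<bar>)"

lemma barnes_ratio_of_nat: "v > 1 \<Longrightarrow> barnes_ratio v (int m) = (\<Prod>j\<le>m. half_sech v (real j))"
proof -
  assume "v > 1"
  have "nat \<bar>int m + 1\<bar> = Suc m" by simp
  with barnes_pos[OF \<open>v > 1\<close>, of m] show ?thesis by (simp add: barnes_ratio_def barnes_Suc)
qed

lemma barnes_ratio_neg: "v > 1 \<Longrightarrow> barnes_ratio v (- int (Suc m)) = 1 / (\<Prod>j\<le>m. half_sech v (real j))"
proof -
  assume "v > 1"
  have "nat \<bar>- int (Suc m) + 1\<bar> = m" "nat \<bar>- int (Suc m)\<bar> = Suc m" by auto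
  with barnes_pos[OF \<open>v > 1\<close>, of m] show ?thesis by (simp only: barnes_ratio_def barnes_Suc) simp
qed

text \<open>The correction to the recursion for \<open>barnes_ratio\<close> where the argument crosses the reflection point.
  It is rational valued, as it enters the constant \<open>c\<close> of the spectral transfer morphism.\<close>

definition crossing :: "int \<Rightarrow> rat" where
  "crossing x = (if x = 0 then 1/2 else 1)"

text \<open>On each side of \<open>0\<close> the ratio is a product of \<open>g\<close> over an initial segment, or its inverse, which
  grows or shrinks by one factor. From \<open>x = -1\<close> to \<open>x = 0\<close> it passes from \<open>1 / g(0)\<close> to \<open>g(0)\<close>, and
  \<open>g(0) = 1/2\<close>.\<close>

lemma barnes_ratio_step:
  assumes v: "v > 1"
  shows "barnes_ratio v (x + 1) = barnes_ratio v x * half_sech v (of_int (x + 1)) * of_rat (crossing (x + 1))"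
proof -
  consider m where "x = int m" | "x = -1" | m where "x = - int (Suc (Suc m))"
  proof (cases "x \<ge> 0 \<or> x = -1")
    case False
    then have "x = - int (Suc (Suc (nat (- x - 2))))" by simp
    then show ?thesis using that by blast
  qed (use that nonneg_int_cases in blast)
  then show ?thesis
  proof cases
    case 1
    have "x + 1 = int (Suc m)" using 1 by simp
    with 1 v show ?thesis by (simp only: barnes_ratio_of_nat) (simp add: crossing_def add.commute)
  next
    case 2
    then show ?thesis using v barnes_ratio_of_nat[OF v, of 0] barnes_ratio_neg[OF v, of 0]
      by (simp add: crossing_def half_sech_zero of_rat_divide)
  next
    case 3
    have x1: "x + 1 = - int (Suc m)" using 3 by simp
    let ?c = "half_sech v (real_of_int (x + 1))"
    have "(\<Prod>j\<le>Suc m. half_sech v (real j)) = (\<Prod>j\<le>m. half_sech v (real j)) * ?c"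
      using half_sech_minus[OF v, of "real (Suc m)"] unfolding x1 by simp
    then have "barnes_ratio v x = 1 / ((\<Prod>j\<le>m. half_sech v (real j)) * ?c)"
      unfolding 3 barnes_ratio_neg[OF v] by (simp only: 3)
    moreover have "barnes_ratio v (x + 1) = 1 / (\<Prod>j\<le>m. half_sech v (real j))"
      unfolding x1 by (rule barnes_ratio_neg[OF v])
    moreover have "crossing (x + 1) = 1" unfolding x1 by (simp add: crossing_def)
    ultimately show ?thesis using half_sech_pos[OF v, of "real_of_int (x + 1)"] by simp
  qed
qed

lemma barnes_ratio_prod:
  assumes v: "v > 1"
  shows "barnes_ratio v (x + int m) = barnes_ratio v x *
     (\<Prod>i=1..m. half_sech v (of_int (x + int i))) * of_rat (\<Prod>i=1..m. crossing (x + int i))"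
proof (induction m)
  case (Suc m)
  have "barnes_ratio v (x + int (Suc m)) = barnes_ratio v ((x + int m) + 1)" by (simp add: ac_simps)
  also have "\<dots> = barnes_ratio v (x + int m) * half_sech v (of_int (x + int (Suc m))) *
      of_rat (crossing (x + int (Suc m)))"
    unfolding barnes_ratio_step[OF v] by (simp add: ac_simps)
  finally show ?case unfolding Suc.IH by (simp add: of_rat_mult ac_simps)
qed simp

lemma prod_symmetric:
  fixes f :: "int \<Rightarrow> 'a::comm_monoid_mult"
  shows "(\<Prod>i=1..2 * k. f (x - int k + int i)) = (\<Prod>b=1..k. f (x + int b) * f (x + 1 - int b))"
proof -
  have "(\<Prod>b=1..k. f (x + 1 - int b)) = (\<Prod>i=1..k. f (x - int k + int i))"
    by (rule prod.reindex_bij_witness[of _ "\<lambda>d. Suc k - d" "\<lambda>b. Suc k - b"])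
       (auto simp: of_nat_diff algebra_simps)
  moreover have "(\<Prod>b=1..k. f (x + int b)) = (\<Prod>i=k+1..k+k. f (x - int k + int i))"
    by (rule prod.reindex_bij_witness[of _ "\<lambda>d. d - k" "\<lambda>b. b + k"])
       (auto simp: of_nat_diff algebra_simps)
  moreover have "(\<Prod>i=1..k+k. f (x - int k + int i)) =
     (\<Prod>i=1..k. f (x - int k + int i)) * (\<Prod>i=k+1..k+k. f (x - int k + int i))"
    by (rule prod.ub_add_nat) simp
  ultimately show ?thesis by (simp only: prod.distrib mult_2) (simp only: mult.commute)
qed

lemma d_factor_barnes:
  assumes "mm - mp = of_int a" "mm + mp = of_int b"
  shows "d_factor N mm mp v = (v - inverse v) powi (- int N) * barnes v (nat \<bar>a\<bar>) * barnes v (nat \<bar>b\<bar>)"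
  unfolding d_factor_def Let_def barnes_def half_sech_def assms by (simp flip: of_int_abs)

text \<open>The two quotients in question are \<open>barnes_ratio\<close> at \<open>x - k\<close> and \<open>x + k\<close>, where \<open>m\<^sub>- = x + 1/2\<close>; so \<open>2k\<close> steps of
  the recursion compare them.\<close>

lemma d_factor_ratio:
  assumes v: "v > 1" and mm: "mm = of_int x + 1/2" and mp: "mp = real k + 1/2"
  shows "d_factor (n + k) mm (mp - 1) v *
      (\<Prod>b=1..k. half_sech v (mm + (real b - 1/2)) * half_sech v (mm - (real b - 1/2))) *
      (v - inverse v) ^ k * of_rat (\<Prod>i=1..2 * k. crossing (x - int k + int i)) =
    d_factor n mm mp v"
proof -
  have 1: "d_factor (n + k) mm (mp - 1) v = (v - inverse v) powi (- int (n + k)) *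
      barnes v (nat \<bar>x - int k + 1\<bar>) * barnes v (nat \<bar>x + int k\<bar>)"
    by (rule d_factor_barnes) (simp_all add: mm mp)
  have 2: "d_factor n mm mp v = (v - inverse v) powi (- int n) *
      barnes v (nat \<bar>x - int k\<bar>) * barnes v (nat \<bar>x + int k + 1\<bar>)"
    by (rule d_factor_barnes) (simp_all add: mm mp)
  have "inverse v < v" using v by (metis inverse_less_1_iff less_trans not_le zero_less_one order_less_imp_le)
  then have nz: "v - inverse v \<noteq> 0" by simp
  have pw: "(v - inverse v) powi (- int n) = (v - inverse v) powi (- int (n + k)) * (v - inverse v) ^ k"
    using power_int_add[of "v - inverse v" "- int (n + k)" "int k"] nz by simp
  let ?P = "\<Prod>b=1..k. half_sech v (mm + (real b - 1/2)) * half_sech v (mm - (real b - 1/2))"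
  let ?c = "of_rat (\<Prod>i=1..2 * k. crossing (x - int k + int i)) :: real"
  have P: "?P = (\<Prod>i=1..2 * k. half_sech v (of_int (x - int k + int i)))"
    unfolding prod_symmetric[of "\<lambda>i. half_sech v (of_int i)"] by (intro prod.cong) (auto simp: mm algebra_simps)
  have "barnes_ratio v (x - int k + int (2 * k)) = barnes_ratio v (x - int k) * ?P * ?c"
    unfolding P by (rule barnes_ratio_prod[OF v])
  then have "barnes v (nat \<bar>x + int k + 1\<bar>) / barnes v (nat \<bar>x + int k\<bar>) =
      barnes v (nat \<bar>x - int k + 1\<bar>) / barnes v (nat \<bar>x - int k\<bar>) * ?P * ?c"
    unfolding barnes_ratio_def by (simp add: add.commute)
  then have "barnes v (nat \<bar>x - int k\<bar>) * barnes v (nat \<bar>x + int k + 1\<bar>) =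
     barnes v (nat \<bar>x - int k + 1\<bar>) * barnes v (nat \<bar>x + int k\<bar>) * ?P * ?c"
    using barnes_pos[OF v, of "nat \<bar>x - int k\<bar>"] barnes_pos[OF v, of "nat \<bar>x + int k\<bar>"]
    by (simp add: field_simps)
  then show ?thesis unfolding 1 2 pw by (simp add: mult.assoc mult.left_commute)
qed

text \<open>Matches the two \<open>m\<^sub>-\<close>-factors of a constant short root with values \<open>v\<^sup>\<plusminus>\<^sup>2\<^sup>w\<close> with the factors of \<open>d\<close>.\<close>

lemma half_sech_pair:
  assumes v: "v > 1"
  shows "(1 + v powr (- 2 * m) * v powr (- 2 * w)) * (1 + v powr (- 2 * m) * v powr (2 * w)) *
      (v powr (2 * m) * (half_sech v (m + w) * half_sech v (m - w))) = 1"
proof -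
  define A B where "A = v powr m" and "B = v powr w"
  have A: "A > 0" and B: "B > 0" using v by (auto simp: A_def B_def)
  have 1: "v powr (- 2 * m) = 1 / (A * A)" "v powr (2 * m) = A * A" "v powr (- 2 * w) = 1 / (B * B)"
    "v powr (2 * w) = B * B"
    by (simp_all add: A_def B_def powr_minus powr_add[symmetric] field_simps)
  have 2: "half_sech v (m + w) = A * B / (1 + A * A * (B * B))" "half_sech v (m - w) = A * B / (B * B + A * A)"
    unfolding half_sech_eq[OF v] using A B
    by (simp_all add: A_def[symmetric] B_def[symmetric] powr_add powr_minus powr_diff field_simps)
  have "B * B + A * A \<noteq> 0" "1 + A * A * (B * B) \<noteq> 0" using A B by (auto simp: add_pos_pos less_imp_neq[symmetric])
  then show ?thesis unfolding 1 2 using A B by (simp add: divide_simps) (simp add: algebra_simps)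
qed

text \<open>Everything independent of the torus coordinates, apart from the sign in \<open>constant_factors\<close>. The
  exponents of \<open>v\<close> add up for all \<open>n\<close>, \<open>k\<close> and \<open>m\<^sub>-\<close>.\<close>

lemma constant_identity:
  assumes v: "v > 1" and mm: "mm = of_int x + 1/2"
  shows "d_factor (n + k) mm (real k - 1/2) v *
      v powr (- 2 * (real (n + k) * (real k - 1/2 + mm) + real (n + k) * (real (n + k) - 1))) *
      ((v powi (4 * int k - 2)) ^ n * ((v ^ (4 * k * (k - 1)) * (v ^ 2 - 1) ^ k) /
      (\<Prod>b=1..k. (1 + v powr (- 2 * mm) * v powi (1 - 2 * int b)) *
         (1 + v powr (- 2 * mm) * v powi (2 * int b - 1))))) *
      of_rat (\<Prod>i=1..2 * k. crossing (x - int k + int i)) =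
    d_factor n mm (real k + 1/2) v *
      v powr (- 2 * (real n * (real k + 1/2 + mm) + real n * (real n - 1)))"
proof -
  let ?D = "\<Prod>b=1..k. (1 + v powr (- 2 * mm) * v powi (1 - 2 * int b)) *
         (1 + v powr (- 2 * mm) * v powi (2 * int b - 1))"
  let ?G = "\<Prod>b=1..k. half_sech v (mm + (real b - 1/2)) * half_sech v (mm - (real b - 1/2))"
  let ?c = "of_rat (\<Prod>i=1..2 * k. crossing (x - int k + int i)) :: real"
  let ?d2 = "d_factor (n + k) mm (real k - 1/2) v"
  have pw: "v powi j = v powr of_int j" for j
    using v by (cases "j \<ge> 0") (auto simp: powr_real_of_int power_int_def power_inverse)
  have "?D * (v powr (2 * mm * real k) * ?G) = 1"
  proof -
    have "v powr (2 * mm * real k) = (\<Prod>b=1..k. v powr (2 * mm))"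
      using v by (simp add: powr_powr[symmetric] powr_realpow)
    then have "?D * (v powr (2 * mm * real k) * ?G) = (\<Prod>b=1..k.
        (1 + v powr (- 2 * mm) * v powi (1 - 2 * int b)) * (1 + v powr (- 2 * mm) * v powi (2 * int b - 1)) *
        (v powr (2 * mm) * (half_sech v (mm + (real b - 1/2)) * half_sech v (mm - (real b - 1/2)))))"
      by (simp only: prod.distrib)
    also have "\<dots> = (\<Prod>b=1..k. 1)"
    proof (rule prod.cong[OF refl])
      fix b
      show "(1 + v powr (- 2 * mm) * v powi (1 - 2 * int b)) * (1 + v powr (- 2 * mm) * v powi (2 * int b - 1)) *
        (v powr (2 * mm) * (half_sech v (mm + (real b - 1/2)) * half_sech v (mm - (real b - 1/2)))) = 1"
        using half_sech_pair[OF v, of mm "real b - 1/2"] unfolding pw by (simp add: algebra_simps)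
    qed
    finally show ?thesis by simp
  qed
  then have D: "inverse ?D = v powr (2 * mm * real k) * ?G" by (rule inverse_unique)
  have d: "d_factor n mm (real k + 1/2) v = ?d2 * ?G * (v - inverse v) ^ k * ?c"
    using d_factor_ratio[OF v mm refl, of n k] by simp
  have "v ^ 2 - 1 = v * (v - inverse v)" using v by (simp add: power2_eq_square algebra_simps)
  then have q: "(v ^ 2 - 1) ^ k = v powr real k * (v - inverse v) ^ k"
    using v by (simp add: power_mult_distrib powr_realpow)
  have e1: "(v powi (4 * int k - 2)) ^ n = v powr ((4 * real k - 2) * real n)"
    unfolding pw using v by (simp add: powr_powr[symmetric] powr_realpow)
  have e2: "v ^ (4 * k * (k - 1)) = v powr (4 * real k * (real k - 1))"
    using v by (cases k) (simp_all add: powr_realpow[symmetric])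
  let ?a = "- 2 * (real (n + k) * (real k - 1/2 + mm) + real (n + k) * (real (n + k) - 1))"
  have "?d2 * v powr ?a * ((v powi (4 * int k - 2)) ^ n * ((v ^ (4 * k * (k - 1)) * (v ^ 2 - 1) ^ k) / ?D)) * ?c =
     (?d2 * ?G * (v - inverse v) ^ k * ?c) * (v powr ?a * v powr ((4 * real k - 2) * real n) *
       v powr (4 * real k * (real k - 1)) * v powr real k * v powr (2 * mm * real k))"
    unfolding e1 e2 q divide_inverse[of _ ?D] D by (simp only: ac_simps)
  also have "v powr ?a * v powr ((4 * real k - 2) * real n) *
       v powr (4 * real k * (real k - 1)) * v powr real k * v powr (2 * mm * real k) =
      v powr (- 2 * (real n * (real k + 1/2 + mm) + real n * (real n - 1)))"
    unfolding powr_add[symmetric] by (rule arg_cong[of _ _ "(powr) v"]) (simp add: field_simps)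
  finally show ?thesis unfolding d .
qed

section \<open>Residuality of the image\<close>

lemma vpow_of_int: "v > 0 \<Longrightarrow> vpow v (of_int j) = complex_of_real v powi j"
  unfolding vpow_def by (cases "j \<ge> 0") (auto simp: powr_real_of_int power_int_def power_inverse)

lemma charval_short_root: "i \<in> {1..N} \<Longrightarrow> charval N (short_root i s) t = t i powi s"
proof -
  assume i: "i \<in> {1..N}"
  have "charval N (short_root i s) t = (\<Prod>j\<in>{1..N}. if j = i then t j powi s else 1)"
    unfolding charval_def short_root_def by (intro prod.cong) auto
  with i show ?thesis by simp
qed

lemma charval_long_root:
  assumes "i \<in> {1..N}" "j \<in> {1..N}" "i < j"
  shows "charval N (long_root i j s s') t = t i powi s * t j powi s'"
proof -
  have "charval N (long_root i j s s') t =
      (\<Prod>l\<in>{1..N}. (if l = i then t l powi s else 1) * (if l = j then t l powi s' else 1))"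
    unfolding charval_def long_root_def using assms by (intro prod.cong) auto
  with assms show ?thesis by (simp add: prod.distrib)
qed

text \<open>Doubling the \<open>i\<close>-th coordinate multiplies the character by \<open>2\<^sup>\<plusminus>\<^sup>1\<close>.\<close>

lemma emb_not_constant:
  assumes w: "\<And>i. w i \<noteq> 0" and i: "i \<in> {1..n}" "x i = 1 \<or> x i = -1"
  shows "\<exists>t\<in>emb n k w ` carrier (torus n). charval (n + k) x t \<noteq> c"
proof (rule ccontr)
  assume "\<not> ?thesis"
  then have c: "charval (n + k) x (emb n k w t) = c" if "t \<in> carrier (torus n)" for t
    using that by blast
  let ?K = "\<Prod>i\<in>{n+1..n+k}. w i powi x i"
  let ?t = "\<lambda>z. \<lambda>j\<in>{1..n}. if j = i then z else (1 :: complex)"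
  have "charval n y (?t z) = z powi y i" for y z
  proof -
    have "charval n y (?t z) = (\<Prod>j\<in>{1..n}. if j = i then z powi y i else 1)"
      unfolding charval_def by (intro prod.cong) auto
    with i show ?thesis by simp
  qed
  then have v: "charval (n + k) x (emb n k w (?t z)) = ?K * z powi x i" for z
    unfolding charval_emb[OF w] using i by simp
  have "?K * 1 powi x i = ?K * 2 powi x i"
    using c[of "?t 1"] c[of "?t 2"] unfolding v by (auto simp: carrier_torus)
  moreover have "?K \<noteq> 0" using w by simp
  ultimately have "1 powi x i = (2::complex) powi x i" by (metis mult_left_cancel)
  with i(2) show False by (auto simp: power_int_minus)
qed

text \<open>For \<open>i \<le> n\<close> the truncated subtraction gives the value \<open>1\<close>, so that no coordinate vanishes.\<close>

definition special_point :: "nat \<Rightarrow> real \<Rightarrow> nat \<Rightarrow> complex" where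
  "special_point n v i = complex_of_real v ^ (2 * (i - n) - 1)"

lemma phi_T_emb: "phi_T n k v = emb n k (special_point n v)"
  by (intro ext) (simp add: phi_T_def emb_def special_point_def)

lemma special_point_nz: "v > 1 \<Longrightarrow> special_point n v i \<noteq> 0"
  by (simp add: special_point_def)

lemma special_point_powi: "b \<ge> 1 \<Longrightarrow> special_point n v (n + b) = complex_of_real v powi (2 * int b - 1)"
proof -
  assume "b \<ge> 1"
  then have "2 * int b - 1 = int (2 * b - 1)" by simp
  then show ?thesis unfolding special_point_def by (simp only: power_int_of_nat add_diff_cancel_left')
qed

definition phi_coset :: "nat \<Rightarrow> nat \<Rightarrow> real \<Rightarrow> (nat \<Rightarrow> complex) set" where
  "phi_coset n k v = emb n k (special_point n v) ` carrier (torus n)"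

text \<open>The elements of \<open>p\<^sub>+(L)\<close>: consecutive special coordinates have ratio \<open>v\<^sup>2\<close>, and the last one is
  \<open>v\<close> to the power \<open>2(m\<^sub>+ - 1)\<close>.\<close>

definition pole_roots :: "nat \<Rightarrow> nat \<Rightarrow> (nat \<Rightarrow> int) set" where
  "pole_roots n k = (if k = 0 then {} else {short_root (n + k) (-1)}) \<union>
     (\<lambda>a. long_root (n + a) (n + a + 1) 1 (-1)) ` {1..<k}"

lemma card_pole_roots: "card (pole_roots n k) = k"
proof -
  have inj: "inj_on (\<lambda>a. long_root (n + a) (n + a + 1) 1 (-1)) {1..<k}"
    by (intro inj_onI) (auto dest!: long_root_eqD)
  have "short_root (n + k) (-1) \<noteq> long_root (n + a) (n + a + 1) 1 (-1)" for a
    by (auto simp: short_root_def long_root_def fun_eq_iff intro!: exI[of _ "n + a"])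
  then have "short_root (n + k) (-1) \<notin> (\<lambda>a. long_root (n + a) (n + a + 1) 1 (-1)) ` {1..<k}"
    by blast
  then show ?thesis using card_image[OF inj] unfolding pole_roots_def by (cases k) simp_all
qed

text \<open>Either the root involves one of the first \<open>n\<close> coordinates, and then varies along the image of the
  embedding, or it is constant there.\<close>

lemma roots_B_cases:
  assumes "\<alpha> \<in> roots_B (n + k)"
  obtains (moving) i where "i \<in> {1..n}" "\<alpha> i = 1 \<or> \<alpha> i = -1"
    | (short) b s where "\<alpha> = short_root (n + b) s" "b \<in> {1..k}" "s \<in> {1, -1}"
    | (long) a b s s' where "\<alpha> = long_root (n + a) (n + b) s s'" "b \<in> {1..k}" "a \<in> {1..<b}"
        "s \<in> {1, -1}" "s' \<in> {1, -1}"
proof -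
  from assms consider "\<alpha> \<in> short_roots (n + k)" | "\<alpha> \<in> long_roots (n + k)"
    by (auto simp: roots_B_def)
  then show ?thesis
  proof cases
    case 1
    then obtain i s where \<alpha>: "\<alpha> = short_root i s" "i \<in> {1..n+k}" "s \<in> {1, -1}" by (rule short_rootE)
    show ?thesis
    proof (cases "i \<le> n")
      case True
      then show ?thesis using \<alpha> by (intro moving[of i]) (auto simp: short_root_def)
    next
      case False
      then show ?thesis using \<alpha> by (intro short[of "i - n" s]) auto
    qed
  next
    case 2
    then obtain i j s s' where \<alpha>: "\<alpha> = long_root i j s s'" "i \<in> {1..n+k}" "j \<in> {1..n+k}" "i < j"
      "s \<in> {1, -1}" "s' \<in> {1, -1}" by (rule long_rootE)
    show ?thesis
    proof (cases "i \<le> n")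
      case True
      then show ?thesis using \<alpha> by (intro moving[of i]) (auto simp: long_root_def)
    next
      case False
      then show ?thesis using \<alpha> by (intro long[of "i - n" "j - n" s s']) auto
    qed
  qed
qed

lemma short_root_notin_long: "short_root i s \<notin> long_roots N"
proof
  assume "short_root i s \<in> long_roots N"
  then obtain a b u u' where *: "short_root i s = long_root a b u u'" "a < b" "u \<in> {1, -1}" "u' \<in> {1, -1}"
    by (rule long_rootE)
  then have "short_root i s x = long_root a b u u' x" for x by simp
  from this[of a] this[of b] *(2-) show False
    by (auto simp: short_root_def long_root_def split: if_splits)
qed


lemma hecke_B_simps:
  "rank (hecke_B P N mm mp) = N"
  "m_plus (hecke_B P N mm mp) (short_root i s) = mp"
  "m_minus (hecke_B P N mm mp) (short_root i s) = mm"
  "\<alpha> \<in> long_roots N \<Longrightarrow> m_plus (hecke_B P N mm mp) \<alpha> = 1"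
  "\<alpha> \<in> long_roots N \<Longrightarrow> m_minus (hecke_B P N mm mp) \<alpha> = 0"
  by (auto simp: m_plus_def m_minus_def hecke_B_def short_root_notin_long)

lemma mu_prefactor_hecke_B:
  assumes "positive_roots N P"
  shows "mu_prefactor (hecke_B P N mm mp) v = complex_of_real
    (d_factor N mm mp v * v powr (- 2 * (real N * (mp + mm) + real N * (real N - 1))))"
proof -
  have "(\<Sum>\<alpha>\<in>P. m_plus (hecke_B P N mm mp) \<alpha> + m_minus (hecke_B P N mm mp) \<alpha>) =
      real N * (mp + mm) + real N * (real N - 1) * 1"
  proof (rule sum_positive_roots[OF assms])
    fix \<alpha> assume "\<alpha> \<in> short_roots N"
    then show "m_plus (hecke_B P N mm mp) \<alpha> + m_minus (hecke_B P N mm mp) \<alpha> = mp + mm"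
      by (elim short_rootE) (simp add: hecke_B_simps)
  qed (simp add: hecke_B_simps)
  then show ?thesis by (simp add: mu_prefactor_def vpow_def hecke_B_def)
qed

definition mu_factor :: "hecke_data \<Rightarrow> real \<Rightarrow> (nat \<Rightarrow> int) \<Rightarrow> (nat \<Rightarrow> complex) \<Rightarrow> complex" where
  "mu_factor H v \<alpha> t = root_fac (vpow v (- 2 * m_plus H \<alpha>)) (vpow v (- 2 * m_minus H \<alpha>))
     (inverse (charval (rank H) \<alpha> t))"

lemma mu_fun_factor: "mu_fun H v t = mu_prefactor H v * (\<Prod>\<alpha>\<in>roots_B (rank H). mu_factor H v \<alpha> t)"
  unfolding mu_fun_def mu_factor_def root_fac_def
  by (intro arg_cong2[where f = "(*)"] prod.cong refl) (simp add: power_int_minus power_inverse mult.commute)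

text \<open>The factor of the regularised \<open>\<mu>\<close>-function at \<open>\<alpha>\<close>. Only \<open>p\<^sub>+(L) = pole_roots n k\<close> is nonempty, so only
  factors of one kind are deleted.\<close>

definition mu_factor_reg :: "nat \<Rightarrow> nat \<Rightarrow> hecke_data \<Rightarrow> real \<Rightarrow> (nat \<Rightarrow> int) \<Rightarrow> (nat \<Rightarrow> complex) \<Rightarrow> complex" where
  "mu_factor_reg n k H v \<alpha> t = (let y = inverse (charval (rank H) \<alpha> t) in
     (1 - y ^ 2) / ((1 + vpow v (- 2 * m_minus H \<alpha>) * y) *
       (if \<alpha> \<in> pole_roots n k then 1 else 1 - vpow v (- 2 * m_plus H \<alpha>) * y)))"

abbreviation "reg_at n k H v \<alpha> t \<equiv> mu_factor_reg n k H v \<alpha> (emb n k (special_point n v) t)"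

context
  fixes n k :: nat and mm v :: real and P2 :: "(nat \<Rightarrow> int) set" and H2
  assumes v: "v > 1"
  defines "H2 \<equiv> hecke_B P2 (n + k) mm (real k - 1/2)"
begin

private abbreviation "V \<equiv> complex_of_real v"

lemma H2_simps:
  "rank H2 = n + k"
  "m_plus H2 (short_root i s) = real k - 1/2"
  "m_minus H2 (short_root i s) = mm"
  "\<alpha> \<in> long_roots (n + k) \<Longrightarrow> m_plus H2 \<alpha> = 1"
  "\<alpha> \<in> long_roots (n + k) \<Longrightarrow> m_minus H2 \<alpha> = 0"
  by (simp_all add: H2_def hecke_B_simps)

lemma powi_inj: "V powi i = V powi j \<longleftrightarrow> i = j"
proof -
  have "v powi i < v powi j" if "i < j" for i j
    using v that by (intro power_int_strict_increasing)
  then have "v powi i = v powi j \<longleftrightarrow> i = j" by (metis less_irrefl linorder_neqE)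
  then show ?thesis unfolding of_real_power_int[symmetric] of_real_eq_iff .
qed

lemma powi_ne_minus: "- (V powi i) \<noteq> complex_of_real a" if "a > 0"
proof -
  have "v powi i + a > 0" using v that by (intro add_pos_pos) auto
  then have "complex_of_real (v powi i + a) \<noteq> 0" by (metis of_real_eq_0_iff less_irrefl)
  then show ?thesis by (metis of_real_add of_real_power_int add.commute add_eq_0_iff)
qed

lemma charval_phi_coset_short:
  assumes "b \<in> {1..k}"
  shows "charval (n + k) (short_root (n + b) s) (emb n k (special_point n v) t) = V powi (s * (2 * int b - 1))"
  unfolding mult.commute[of s] power_int_mult using assms
  by (simp add: charval_short_root emb_def special_point_powi)

lemma charval_phi_coset_long:
  assumes "b \<in> {1..k}" "a \<in> {1..<b}"
  shows "charval (n + k) (long_root (n + a) (n + b) s s') (emb n k (special_point n v) t) =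
     V powi (s * (2 * int a - 1) + s' * (2 * int b - 1))"
proof -
  have "V \<noteq> 0" using v by simp
  then have "V powi (s * (2 * int a - 1) + s' * (2 * int b - 1)) =
      (V powi (2 * int a - 1)) powi s * (V powi (2 * int b - 1)) powi s'"
    unfolding mult.commute[of s] mult.commute[of s'] by (simp only: power_int_add power_int_mult simp_thms)
  then show ?thesis using assms
    by (simp add: charval_long_root emb_def special_point_powi)
qed

lemma vpow_H2:
  "vpow v (- 2 * m_plus H2 (short_root i s)) = V powi (1 - 2 * int k)"
  "\<alpha> \<in> long_roots (n + k) \<Longrightarrow> vpow v (- 2 * m_plus H2 \<alpha>) = V powi (-2)"
  "vpow v (- 2 * m_minus H2 (short_root i s)) = vpow v (- 2 * mm)"
  "\<alpha> \<in> long_roots (n + k) \<Longrightarrow> vpow v (- 2 * m_minus H2 \<alpha>) = 1"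
  using vpow_of_int[of v "1 - 2 * int k"] vpow_of_int[of v "-2"] vpow_of_int[of v 0] v
  by (simp_all add: H2_simps)

lemma phi_coset_nonempty: "\<exists>t. t \<in> phi_coset n k v"
proof -
  have "\<one>\<^bsub>torus n\<^esub> \<in> carrier (torus n)" by (simp add: carrier_torus one_torus)
  then show ?thesis unfolding phi_coset_def by blast
qed

lemma phi_coset_value:
  assumes "\<And>t. f (emb n k (special_point n v) t) = a"
  shows "(\<forall>t\<in>phi_coset n k v. f t = c) \<longleftrightarrow> a = c"
proof -
  have "f t = a" if "t \<in> phi_coset n k v" for t using that assms by (auto simp: phi_coset_def)
  with phi_coset_nonempty show ?thesis by metis
qed

lemma moving_not_constant:
  "i \<in> {1..n} \<Longrightarrow> \<alpha> i = 1 \<or> \<alpha> i = -1 \<Longrightarrow> \<not> (\<forall>t\<in>phi_coset n k v. charval (n + k) \<alpha> t = c)"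
  unfolding phi_coset_def using emb_not_constant[OF special_point_nz[OF v]] by simp

text \<open>A comparison of exponents of \<open>v\<close>: \<open>\<plusminus>(2b - 1) = 1 - 2k\<close> for short roots,
  \<open>\<plusminus>(2a - 1) \<plusminus> (2b - 1) = -2\<close> with \<open>a < b\<close> for long ones.\<close>

lemma p_plus_phi_coset: "p_plus H2 v (phi_coset n k v) = pole_roots n k"
proof -
  have iff: "\<alpha> \<in> p_plus H2 v (phi_coset n k v) \<longleftrightarrow> \<alpha> \<in> pole_roots n k" if "\<alpha> \<in> roots_B (n + k)" for \<alpha>
    using that
  proof (cases rule: roots_B_cases)
    case (moving i)
    then have "\<alpha> \<notin> p_plus H2 v (phi_coset n k v)"
      unfolding p_plus_def H2_simps(1) using moving_not_constant[of i \<alpha>, OF moving] by simp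
    moreover have "\<alpha> \<notin> pole_roots n k"
      using moving unfolding pole_roots_def
      by (auto simp: short_root_def long_root_def split: if_split_asm)
    ultimately show ?thesis by simp
  next
    case (short b s)
    have "\<alpha> \<in> p_plus H2 v (phi_coset n k v) \<longleftrightarrow> s * (2 * int b - 1) = 1 - 2 * int k"
      using that unfolding p_plus_def H2_simps(1) short(1) vpow_H2(1) mem_Collect_eq
        phi_coset_value[where f = "charval (n + k) _", OF charval_phi_coset_short[OF short(2)]] powi_inj
      by simp
    also have "\<dots> \<longleftrightarrow> s = -1 \<and> b = k" using short by auto
    also have "\<dots> \<longleftrightarrow> \<alpha> \<in> pole_roots n k"
    proof -
      have "(\<lambda>a. long_root (n + a) (n + a + 1) 1 (-1)) ` {1..<k} \<subseteq> long_roots (n + k)"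
        by (auto intro: long_rootI)
      moreover have "\<alpha> \<notin> long_roots (n + k)" unfolding short(1) by (rule short_root_notin_long)
      ultimately have "\<alpha> \<notin> (\<lambda>a. long_root (n + a) (n + a + 1) 1 (-1)) ` {1..<k}" by (rule contra_subsetD)
      then show ?thesis using short by (auto simp: pole_roots_def short_root_eq_iff)
    qed
    finally show ?thesis .
  next
    case (long a b s s')
    have l: "\<alpha> \<in> long_roots (n + k)" using long by (auto intro: long_rootI)
    have "\<alpha> \<in> p_plus H2 v (phi_coset n k v) \<longleftrightarrow> s * (2 * int a - 1) + s' * (2 * int b - 1) = - 2"
      using that unfolding p_plus_def H2_simps(1) mem_Collect_eq vpow_H2(2)[OF l] unfolding long(1)
        phi_coset_value[where f = "charval (n + k) _", OF charval_phi_coset_long[OF long(2,3)]] powi_inj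
      by simp
    also have "\<dots> \<longleftrightarrow> s = 1 \<and> s' = -1 \<and> b = a + 1" using long by auto
    also have "\<dots> \<longleftrightarrow> \<alpha> \<in> pole_roots n k"
    proof
      assume "\<alpha> \<in> pole_roots n k"
      then obtain a' where "\<alpha> = long_root (n + a') (n + a' + 1) 1 (-1)"
        using l short_root_notin_long by (auto simp: pole_roots_def split: if_splits)
      with long show "s = 1 \<and> s' = -1 \<and> b = a + 1" by (auto dest!: long_root_eqD)
    qed (use long in \<open>auto simp: pole_roots_def\<close>)
    finally show ?thesis .
  qed
  have "pole_roots n k \<subseteq> roots_B (n + k)"
    by (auto simp: pole_roots_def roots_B_def intro!: short_rootI long_rootI)
  moreover have "p_plus H2 v (phi_coset n k v) \<subseteq> roots_B (n + k)" by (auto simp: p_plus_def H2_simps(1))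
  ultimately show ?thesis using iff by blast
qed

text \<open>No constant root has the value \<open>v\<^sup>0\<close>: the exponents are odd for short roots, and \<open>\<plusminus>(2a - 1) \<plusminus> (2b - 1)\<close>
  with \<open>a < b\<close> for long ones.\<close>

lemma no_other_value:
  assumes "\<alpha> \<in> roots_B (n + k)" and c: "\<And>e. e \<noteq> 0 \<Longrightarrow> V powi e \<noteq> c"
  shows "\<not> (\<forall>t\<in>phi_coset n k v. charval (n + k) \<alpha> t = c)"
  using assms(1)
proof (cases rule: roots_B_cases)
  case (moving i) then show ?thesis by (rule moving_not_constant)
next
  case (short b s)
  have "s * (2 * int b - 1) \<noteq> 0" using short by auto
  from c[OF this] show ?thesis unfolding short(1)
    phi_coset_value[where f = "charval (n + k) _", OF charval_phi_coset_short[OF short(2)]] .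
next
  case (long a b s s')
  have "s * (2 * int a - 1) + s' * (2 * int b - 1) \<noteq> 0" using long by auto
  from c[OF this] show ?thesis unfolding long(1)
    phi_coset_value[where f = "charval (n + k) _", OF charval_phi_coset_long[OF long(2,3)]] .
qed

lemma uminus_value_iff: "(\<forall>t\<in>L. - f t = c) \<longleftrightarrow> (\<forall>t\<in>L. f t = - c)" for c :: complex
  by (metis minus_minus)

lemma p_minus_phi_coset: "p_minus H2 v (phi_coset n k v) = {}"
proof -
  have "\<not> (\<forall>t\<in>phi_coset n k v. charval (n + k) \<alpha> t = - vpow v a)" if "\<alpha> \<in> roots_B (n + k)" for \<alpha> a
  proof (rule no_other_value[OF that])
    fix e
    show "V powi e \<noteq> - vpow v a"
      using powi_ne_minus[of "v powr a" e] v unfolding vpow_def by (metis minus_minus powr_gt_zero less_irrefl less_trans zero_less_one)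
  qed
  then show ?thesis unfolding p_minus_def H2_simps(1) uminus_value_iff by simp
qed

lemma z_minus_phi_coset: "z_minus H2 (phi_coset n k v) = {}"
proof -
  have "\<not> (\<forall>t\<in>phi_coset n k v. charval (n + k) \<alpha> t = - 1)" if "\<alpha> \<in> roots_B (n + k)" for \<alpha>
  proof (rule no_other_value[OF that])
    fix e
    show "V powi e \<noteq> - 1" using powi_ne_minus[of 1 e] by (metis minus_minus of_real_1 zero_less_one)
  qed
  then show ?thesis unfolding z_minus_def H2_simps(1) uminus_value_iff by simp
qed

lemma z_plus_phi_coset: "z_plus H2 (phi_coset n k v) = {}"
proof -
  have "\<not> (\<forall>t\<in>phi_coset n k v. charval (n + k) \<alpha> t = 1)" if "\<alpha> \<in> roots_B (n + k)" for \<alpha>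
    by (rule no_other_value[OF that]) (use powi_inj[of _ 0] in simp)
  then show ?thesis unfolding z_plus_def H2_simps(1) by simp
qed

lemma residual_phi_coset: "residual_coset H2 v (phi_coset n k v)"
  unfolding residual_coset_def
proof (intro exI conjI)
  show "subtorus_of_dim (rank H2) n (emb n k (\<lambda>_. 1) ` carrier (torus n))"
    unfolding H2_simps(1) by (rule subtorus_emb_one)
  show "emb n k (special_point n v) \<one>\<^bsub>torus n\<^esub> \<in> carrier (torus (rank H2))"
    unfolding H2_simps(1) using v
    by (intro emb_carrier special_point_nz) (auto simp: carrier_torus one_torus)
  show "phi_coset n k v = emb n k (special_point n v) \<one>\<^bsub>torus n\<^esub> <#\<^bsub>torus (rank H2)\<^esub>
      (emb n k (\<lambda>_. 1) ` carrier (torus n))"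
    unfolding H2_simps(1) phi_coset_def using v by (intro emb_image_coset special_point_nz)
  show "int (card (p_plus H2 v (phi_coset n k v))) + int (card (p_minus H2 v (phi_coset n k v)))
      - int (card (z_plus H2 (phi_coset n k v))) - int (card (z_minus H2 (phi_coset n k v)))
      = int (rank H2) - int n"
    unfolding p_plus_phi_coset p_minus_phi_coset z_plus_phi_coset z_minus_phi_coset card_pole_roots H2_simps(1)
    by simp
qed

text \<open>The short roots \<open>t\<^sub>n\<^sub>+\<^sub>b\<close> are constant on the coset, and their coroots are twice the coordinate
  cocharacters; these generate all points with first \<open>n\<close> coordinates equal to \<open>1\<close>.\<close>

lemma base_point_T_sub: "emb n k (special_point n v) \<one>\<^bsub>torus n\<^esub> \<in> T_sub H2 (phi_coset n k v)"
proof -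
  let ?L = "phi_coset n k v"
  let ?Y = "{y \<in> lattice_Z (rank H2). \<exists>r :: (nat \<Rightarrow> int) \<Rightarrow> rat.
        \<forall>i. of_int (y i) = (\<Sum>\<alpha>\<in>const_roots H2 ?L. r \<alpha> * of_int (coroot (rank H2) \<alpha> i))}"
  let ?G = "{cocharval (n + k) y z | y z. y \<in> ?Y \<and> z \<noteq> 0}"
  have Y: "short_root (n + b) 1 \<in> ?Y" if b: "b \<in> {1..k}" for b
  proof -
    let ?\<beta> = "short_root (n + b) 1"
    have R: "?\<beta> \<in> const_roots H2 ?L"
      unfolding const_roots_def H2_simps(1) phi_coset_def using b
      by (auto simp: charval_phi_coset_short roots_B_def intro!: short_rootI)
    have fin: "finite (const_roots H2 ?L)"
      using finite_roots_B by (auto simp: const_roots_def)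
    have "(\<Sum>j\<in>{1..n+k}. ?\<beta> j * ?\<beta> j) = (\<Sum>j\<in>{1..n+k}. if j = n + b then 1 else 0)"
      by (intro sum.cong) (auto simp: short_root_def)
    then have norm: "(\<Sum>j\<in>{1..n+k}. ?\<beta> j * ?\<beta> j) = 1" using b by simp
    have "of_int (?\<beta> i) = (\<Sum>\<alpha>\<in>const_roots H2 ?L. (if \<alpha> = ?\<beta> then 1/2 else 0 :: rat) *
        of_int (coroot (rank H2) \<alpha> i))" for i
    proof -
      have "(\<Sum>\<alpha>\<in>const_roots H2 ?L. (if \<alpha> = ?\<beta> then 1/2 else 0 :: rat) * of_int (coroot (rank H2) \<alpha> i)) =
        (\<Sum>\<alpha>\<in>const_roots H2 ?L. if \<alpha> = ?\<beta> then 1/2 * of_int (coroot (rank H2) \<alpha> i) else 0)"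
        by (intro sum.cong) auto
      also have "\<dots> = 1/2 * of_int (coroot (rank H2) ?\<beta> i)" using R fin by simp
      also have "\<dots> = of_int (?\<beta> i)" unfolding coroot_def H2_simps(1) norm by simp
      finally show ?thesis by simp
    qed
    moreover have "?\<beta> \<in> lattice_Z (rank H2)" using b by (auto simp: lattice_Z_def short_root_def H2_simps(1))
    ultimately show ?thesis
      by (intro CollectI conjI exI[of _ "\<lambda>\<alpha>. if \<alpha> = ?\<beta> then 1/2 else 0"] allI)
  qed
  \<comment> \<open>the base point is reached by switching on one special coordinate at a time\<close>
  let ?e = "\<lambda>m. (\<lambda>i\<in>{1..n+k}. if n < i \<and> i \<le> n + m then special_point n v i else 1)"
  have "?e m \<in> generate (torus (n + k)) ?G" if "m \<le> k" for m
    using that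
  proof (induction m)
    case 0
    have "?e 0 = \<one>\<^bsub>torus (n + k)\<^esub>" by (auto simp: one_torus fun_eq_iff)
    then show ?case by (metis generate.one)
  next
    case (Suc m)
    let ?c = "cocharval (n + k) (short_root (n + Suc m) 1) (special_point n v (n + Suc m))"
    have "?c \<in> ?G" using Y[of "Suc m"] Suc.prems special_point_nz[OF v] by auto
    then have c: "?c \<in> generate (torus (n + k)) ?G" by (rule generate.incl)
    have "?e m \<otimes>\<^bsub>torus (n + k)\<^esub> ?c = ?e (Suc m)"
      by (auto simp: mult_torus cocharval_def short_root_def fun_eq_iff le_Suc_eq)
    moreover have "?e m \<otimes>\<^bsub>torus (n + k)\<^esub> ?c \<in> generate (torus (n + k)) ?G"
      by (rule generate.eng[OF Suc.IH c]) (use Suc.prems in simp)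
    ultimately show ?case by (simp only:)
  qed
  from this[of k] have "?e k \<in> generate (torus (n + k)) ?G" by simp
  moreover have "?e k = emb n k (special_point n v) \<one>\<^bsub>torus n\<^esub>"
    by (auto simp: emb_def one_torus fun_eq_iff)
  ultimately show ?thesis unfolding T_sub_def subtorus_with_lattice_def H2_simps(1) by simp
qed

subsection \<open>Restriction of the mu-function\<close>

lemma mu_reg_factor:
  "mu_reg H2 v (phi_coset n k v) t =
     mu_prefactor H2 v * (\<Prod>\<alpha>\<in>roots_B (n + k). mu_factor_reg n k H2 v \<alpha> t)"
proof -
  let ?y = "\<lambda>\<alpha>. inverse (charval (n + k) \<alpha> t)"
  have "(\<Prod>\<alpha>\<in>roots_B (n + k) - pole_roots n k. 1 - vpow v (- 2 * m_plus H2 \<alpha>) * ?y \<alpha>) =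
      (\<Prod>\<alpha>\<in>roots_B (n + k). if \<alpha> \<in> pole_roots n k then 1 else 1 - vpow v (- 2 * m_plus H2 \<alpha>) * ?y \<alpha>)"
    by (rule prod.mono_neutral_cong_left) (auto simp: finite_roots_B)
  moreover have "1 - y ^ 2 = (1 + y) * (1 - y)" for y :: complex
    by (simp add: power2_eq_square algebra_simps)
  ultimately show ?thesis
    unfolding mu_reg_def p_plus_phi_coset p_minus_phi_coset z_plus_phi_coset z_minus_phi_coset H2_simps(1) mu_factor_reg_def Let_def
    by (simp add: power_int_minus prod.distrib prod_dividef)
qed

lemma mu_factor_reg_moving:
  assumes "\<alpha> \<in> roots_B (n + k)" "i \<in> {1..n}" "\<alpha> i = 1 \<or> \<alpha> i = -1"
  shows "mu_factor_reg n k H2 v \<alpha> t = root_fac (vpow v (- 2 * m_plus H2 \<alpha>))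
     (vpow v (- 2 * m_minus H2 \<alpha>)) (inverse (charval (n + k) \<alpha> t))"
proof -
  have "\<alpha> \<notin> pole_roots n k"
    using moving_not_constant[where i = i and \<alpha> = \<alpha>, OF assms(2,3)] unfolding p_plus_phi_coset[symmetric] p_plus_def H2_simps
    by simp
  then show ?thesis by (simp add: mu_factor_reg_def root_fac_def H2_simps Let_def)
qed

text \<open>At a constant root the factor \<open>1 - P y\<close> is deleted precisely when it vanishes, so deletion can be
  expressed by \<open>unit_guard\<close> without listing the poles.\<close>

lemma mu_factor_reg_constant:
  assumes "\<alpha> \<in> roots_B (n + k)" "\<And>t. charval (n + k) \<alpha> (emb n k (special_point n v) t) = a" "a \<noteq> 0"
  shows "mu_factor_reg n k H2 v \<alpha> (emb n k (special_point n v) t) =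
     root_fac_reg (vpow v (- 2 * m_plus H2 \<alpha>)) (vpow v (- 2 * m_minus H2 \<alpha>)) (inverse a)"
proof -
  have "\<alpha> \<in> pole_roots n k \<longleftrightarrow> a = vpow v (- 2 * m_plus H2 \<alpha>)"
    unfolding p_plus_phi_coset[symmetric] p_plus_def H2_simps mem_Collect_eq
      phi_coset_value[where f = "charval (n + k) \<alpha>", OF assms(2)] using assms(1) by simp
  also have "\<dots> \<longleftrightarrow> vpow v (- 2 * m_plus H2 \<alpha>) * inverse a = 1"
    using assms(3) by (auto simp: field_simps)
  finally show ?thesis
    by (simp add: mu_factor_reg_def root_fac_reg_def unit_guard_def H2_simps assms(2) Let_def)
qed

lemma mu_factor_reg_short_moving:
  assumes "i \<in> {1..n}" "s \<in> {1, -1}"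
  shows "reg_at n k H2 v (short_root i s) t =
    root_fac (V powi (1 - 2 * int k)) (vpow v (- 2 * mm)) (inverse (t i powi s))"
proof -
  have R: "short_root i s \<in> roots_B (n + k)" using assms by (auto simp: roots_B_def intro: short_rootI)
  have c: "charval (n + k) (short_root i s) (emb n k (special_point n v) t) = t i powi s"
    using assms by (subst charval_short_root) (auto simp: emb_def)
  have "short_root i s i = 1 \<or> short_root i s i = -1" using assms by (auto simp: short_root_def)
  from mu_factor_reg_moving[OF R assms(1) this, where t = "emb n k (special_point n v) t"] show ?thesis unfolding vpow_H2 c .
qed

lemma mu_factor_reg_long_moving:
  assumes "i \<in> {1..n}" "j \<in> {1..n + k}" "i < j" "s \<in> {1, -1}" "s' \<in> {1, -1}"
  shows "reg_at n k H2 v (long_root i j s s') t =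
    root_fac (V powi (-2)) 1 (inverse (t i powi s * emb n k (special_point n v) t j powi s'))"
proof -
  have l: "long_root i j s s' \<in> long_roots (n + k)" using assms by (auto intro: long_rootI)
  then have R: "long_root i j s s' \<in> roots_B (n + k)" by (simp add: roots_B_def)
  have c: "charval (n + k) (long_root i j s s') (emb n k (special_point n v) t) =
      t i powi s * emb n k (special_point n v) t j powi s'"
    using assms by (subst charval_long_root) (auto simp: emb_def)
  have "long_root i j s s' i = 1 \<or> long_root i j s s' i = -1" using assms by (auto simp: long_root_def)
  from mu_factor_reg_moving[OF R assms(1) this, where t = "emb n k (special_point n v) t"] show ?thesis unfolding vpow_H2(2,4)[OF l] c .
qed

lemma mu_factor_reg_short_constant:
  assumes "b \<in> {1..k}" "s \<in> {1, -1}"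
  shows "reg_at n k H2 v (short_root (n + b) s) t =
    root_fac_reg (V powi (1 - 2 * int k)) (vpow v (- 2 * mm)) (V powi (- (s * (2 * int b - 1))))"
proof -
  have "short_root (n + b) s \<in> roots_B (n + k)" using assms by (auto simp: roots_B_def intro: short_rootI)
  from mu_factor_reg_constant[OF this charval_phi_coset_short[OF assms(1)]] v show ?thesis
    unfolding vpow_H2 by (simp add: power_int_minus)
qed

lemma mu_factor_reg_long_constant:
  assumes "b \<in> {1..k}" "a \<in> {1..<b}" "s \<in> {1, -1}" "s' \<in> {1, -1}"
  shows "reg_at n k H2 v (long_root (n + a) (n + b) s s') t =
    root_fac_reg (V powi (-2)) 1 (V powi (- (s * (2 * int a - 1))) * V powi (- (s' * (2 * int b - 1))))"
proof -
  have l: "long_root (n + a) (n + b) s s' \<in> long_roots (n + k)" using assms by (auto intro: long_rootI)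
  then have "long_root (n + a) (n + b) s s' \<in> roots_B (n + k)" by (simp add: roots_B_def)
  from mu_factor_reg_constant[OF this charval_phi_coset_long[OF assms(1,2)]] v show ?thesis
    unfolding vpow_H2(2,4)[OF l] by (simp add: power_int_minus power_int_add)
qed

text \<open>The hypothesis on \<open>t\<close> excludes the points where a cancelled factor vanishes: numerators \<open>1 - y\<close> in
  the telescoping product, and \<open>1 + y\<close>, which cancels because \<open>m\<^sub>-\<close> vanishes on long roots.\<close>

lemma prod_mu_factor_reg:
  assumes t: "t \<in> carrier (torus n)"
    and gen: "\<And>i j. i \<in> {1..n} \<Longrightarrow> \<bar>j\<bar> \<le> 2 * int k + 1 \<Longrightarrow> odd j \<Longrightarrow> t i \<noteq> V powi j \<and> t i \<noteq> - (V powi j)"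
    and H1: "H1 = hecke_B P1 n mm (real k + 1/2)"
  shows "(\<Prod>\<alpha>\<in>roots_B (n + k). reg_at n k H2 v \<alpha> t) =
    (V powi (4 * int k - 2)) ^ n * (\<Prod>\<alpha>\<in>roots_B n. mu_factor H1 v \<alpha> t) *
    ((if k = 0 then 1 else -1) * (V ^ (4 * k * (k - 1)) * (V ^ 2 - 1) ^ k) /
      (\<Prod>b=1..k. (1 + vpow v (- 2 * mm) * V powi (1 - 2 * int b)) *
         (1 + vpow v (- 2 * mm) * V powi (2 * int b - 1))))"
proof -
  have V0: "V \<noteq> 0" using v by (simp add:)
  have r1: "rank H1 = n" by (simp add: H1 hecke_B_simps)
  have p1: "vpow v (- 2 * m_plus H1 (short_root i s)) = V powi (- 2 * int k - 1)"
    "\<alpha> \<in> long_roots n \<Longrightarrow> vpow v (- 2 * m_plus H1 \<alpha>) = V powi (-2)"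
    "vpow v (- 2 * m_minus H1 (short_root i s)) = vpow v (- 2 * mm)"
    "\<alpha> \<in> long_roots n \<Longrightarrow> vpow v (- 2 * m_minus H1 \<alpha>) = 1" for i s \<alpha>
    using vpow_of_int[of v "- 2 * int k - 1"] vpow_of_int[of v "-2"] vpow_of_int[of v 0] v
    by (simp_all add: H1 hecke_B_simps)
  define S where "S i = reg_at n k H2 v (short_root i 1) t * reg_at n k H2 v (short_root i (-1)) t" for i
  define M where "M i j = (reg_at n k H2 v (long_root i j 1 1) t * reg_at n k H2 v (long_root i j 1 (-1)) t) *
       (reg_at n k H2 v (long_root i j (-1) 1) t * reg_at n k H2 v (long_root i j (-1) (-1)) t)" for i j
  define S1 where "S1 i = mu_factor H1 v (short_root i 1) t * mu_factor H1 v (short_root i (-1)) t" for i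
  define M1 where "M1 i j = (mu_factor H1 v (long_root i j 1 1) t * mu_factor H1 v (long_root i j 1 (-1)) t) *
       (mu_factor H1 v (long_root i j (-1) 1) t * mu_factor H1 v (long_root i j (-1) (-1)) t)" for i j
  have 1: "M i j = M1 i j" if "i \<in> {1..<j}" "j \<in> {1..n}" for i j
  proof -
    have "reg_at n k H2 v (long_root i j s s') t = mu_factor H1 v (long_root i j s s') t"
      if s: "s \<in> {1, -1}" "s' \<in> {1, -1}" for s s'
    proof -
      have ij: "i \<in> {1..n}" "j \<in> {1..n}" "j \<in> {1..n+k}" "i < j"
        using \<open>i \<in> {1..<j}\<close> \<open>j \<in> {1..n}\<close> by auto
      have l: "long_root i j s s' \<in> long_roots n" using ij s by (intro long_rootI)
      have "emb n k (special_point n v) t j = t j" using ij by (simp add: emb_def)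
      then show ?thesis
        unfolding mu_factor_reg_long_moving[OF ij(1,3,4) s] mu_factor_def r1 p1(2,4)[OF l]
          charval_long_root[OF ij(1,2,4)] by simp
    qed
    then show ?thesis by (simp add: M_def M1_def)
  qed
  have 2: "S i * (\<Prod>b=1..k. M i (n + b)) = V powi (4 * int k - 2) * S1 i" if i: "i \<in> {1..n}" for i
  proof -
    have t0: "t i \<noteq> 0" using t i by (auto simp: carrier_torus PiE_iff)
    have S: "S i = root_fac (V powi (1 - 2 * int k)) (vpow v (- 2 * mm)) (inverse (t i)) *
        root_fac (V powi (1 - 2 * int k)) (vpow v (- 2 * mm)) (t i)"
      by (simp add: S_def mu_factor_reg_short_moving[OF i] power_int_minus)
    have S1: "S1 i = root_fac (V powi (- 2 * int k - 1)) (vpow v (- 2 * mm)) (inverse (t i)) *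
        root_fac (V powi (- 2 * int k - 1)) (vpow v (- 2 * mm)) (t i)"
      unfolding S1_def mu_factor_def r1 p1(1,3) charval_short_root[OF i] by (simp add: power_int_minus)
    have M: "M i (n + b) =
        (root_fac (V powi (-2)) 1 (inverse (t i) * V powi (1 - 2 * int b)) *
         root_fac (V powi (-2)) 1 (inverse (t i) * V powi (2 * int b - 1))) *
        (root_fac (V powi (-2)) 1 (t i * V powi (1 - 2 * int b)) *
         root_fac (V powi (-2)) 1 (t i * V powi (2 * int b - 1)))" if b: "b \<in> {1..k}" for b
    proof -
      have e: "emb n k (special_point n v) t (n + b) = V powi (2 * int b - 1)"
        using b special_point_powi[of b n v] by (simp add: emb_def)
      have "V powi (1 - 2 * int b) = V powi (- (2 * int b - 1))" by simp
      then have inv: "V powi (1 - 2 * int b) = inverse (V powi (2 * int b - 1))" by (simp only: power_int_minus)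
      have j: "n + b \<in> {1..n + k}" "i < n + b" using b i by auto
      show ?thesis unfolding M_def
        by (simp add: mu_factor_reg_long_moving[OF i j] e inv power_int_minus)
    qed
    have M': "(\<Prod>b=1..k. M i (n + b)) = (\<Prod>b=1..k.
        (root_fac (V powi (-2)) 1 (inverse (t i) * V powi (1 - 2 * int b)) *
         root_fac (V powi (-2)) 1 (inverse (t i) * V powi (2 * int b - 1))) *
        (root_fac (V powi (-2)) 1 (t i * V powi (1 - 2 * int b)) *
         root_fac (V powi (-2)) 1 (t i * V powi (2 * int b - 1))))"
      by (rule prod.cong[OF refl M])
    show ?thesis unfolding S S1 M' by (rule mixed_factors[OF V0 t0 gen[OF i]])
  qed
  have 3: "S (n + b) * (\<Prod>a=1..<b. M (n + a) (n + b)) =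
      (root_fac_reg (V powi (1 - 2 * int k)) (vpow v (- 2 * mm)) (V powi (1 - 2 * int b)) *
       root_fac_reg (V powi (1 - 2 * int k)) (vpow v (- 2 * mm)) (V powi (2 * int b - 1))) *
      (\<Prod>a=1..<b.
        (root_fac_reg (V powi (-2)) 1 (V powi (1 - 2 * int a) * V powi (1 - 2 * int b)) *
         root_fac_reg (V powi (-2)) 1 (V powi (1 - 2 * int a) * V powi (2 * int b - 1))) *
        (root_fac_reg (V powi (-2)) 1 (V powi (2 * int a - 1) * V powi (1 - 2 * int b)) *
         root_fac_reg (V powi (-2)) 1 (V powi (2 * int a - 1) * V powi (2 * int b - 1))))"
    if b: "b \<in> {1..k}" for b
    unfolding S_def M_def
    by (intro arg_cong2[where f = "(*)"] prod.cong refl) (simp_all add: mu_factor_reg_short_constant[OF b] mu_factor_reg_long_constant[OF b])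
  have "(\<Prod>\<alpha>\<in>roots_B (n + k). reg_at n k H2 v \<alpha> t) =
      ((\<Prod>i=1..n. S i * (\<Prod>b=1..k. M i (n + b))) * (\<Prod>j=1..n. \<Prod>i=1..<j. M i j)) *
    (\<Prod>b=1..k. S (n + b) * (\<Prod>a=1..<b. M (n + a) (n + b)))"
    unfolding S_def M_def by (rule prod_roots_B_add)
  also have "(\<Prod>i=1..n. S i * (\<Prod>b=1..k. M i (n + b))) = (V powi (4 * int k - 2)) ^ n * (\<Prod>i=1..n. S1 i)"
    by (simp only: 2 cong: prod.cong) (simp add: prod.distrib)
  also have "(\<Prod>j=1..n. \<Prod>i=1..<j. M i j) = (\<Prod>j=1..n. \<Prod>i=1..<j. M1 i j)"
    by (intro prod.cong refl 1)
  also have "(\<Prod>b=1..k. S (n + b) * (\<Prod>a=1..<b. M (n + a) (n + b))) =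
     ((if k = 0 then 1 else -1) * (V ^ (4 * k * (k - 1)) * (V ^ 2 - 1) ^ k) /
      (\<Prod>b=1..k. (1 + vpow v (- 2 * mm) * V powi (1 - 2 * int b)) *
         (1 + vpow v (- 2 * mm) * V powi (2 * int b - 1))))"
    using constant_factors[OF v, of k "vpow v (- 2 * mm)"] by (simp only: 3 cong: prod.cong)
  also have "(V powi (4 * int k - 2)) ^ n * (\<Prod>i=1..n. S1 i) * (\<Prod>j=1..n. \<Prod>i=1..<j. M1 i j) =
      (V powi (4 * int k - 2)) ^ n * (\<Prod>\<alpha>\<in>roots_B n. mu_factor H1 v \<alpha> t)"
    unfolding prod.roots_B prod.short_roots prod.long_roots S1_def M1_def by (simp only: mult.assoc)
  finally show ?thesis .
qed

end

section \<open>The spectral transfer morphism\<close>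

lemma prefactor_identity:
  assumes v: "v > 1" and mm: "mm = of_int x + 1/2"
    and P: "positive_roots n P1" "positive_roots (n + k) P2"
  defines "V \<equiv> complex_of_real v"
  shows "mu_prefactor (hecke_B P2 (n + k) mm (real k - 1/2)) v *
      ((V powi (4 * int k - 2)) ^ n * ((V ^ (4 * k * (k - 1)) * (V ^ 2 - 1) ^ k) /
      (\<Prod>b=1..k. (1 + vpow v (- 2 * mm) * V powi (1 - 2 * int b)) *
         (1 + vpow v (- 2 * mm) * V powi (2 * int b - 1))))) *
      of_rat (\<Prod>i=1..2 * k. crossing (x - int k + int i)) =
    mu_prefactor (hecke_B P1 n mm (real k + 1/2)) v"
proof -
  have rat: "complex_of_real (of_rat r) = of_rat r" for r
  proof (cases r)
    case (Fract a b)
    then show ?thesis by (simp add: of_rat_rat)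
  qed
  show ?thesis
    unfolding mu_prefactor_hecke_B[OF P(1)] mu_prefactor_hecke_B[OF P(2)] constant_identity[OF v mm, symmetric]
    unfolding V_def vpow_def by (simp add: rat)
qed

theorem mainTheorem1:
  fixes n k :: nat and mm mp :: real and P1 P2 :: "(nat \<Rightarrow> int) set"
  assumes "mm - 1/2 \<in> \<int>" and "mp - 1/2 \<in> \<int>" and "mp > 0"
    and "real k = mp - 1/2"
    and "positive_roots n P1" and "positive_roots (n + k) P2"
  shows "spectral_transfer_morphism
           (hecke_B P1 n mm mp) (hecke_B P2 (n + k) mm (mp - 1)) (phi_T n k)"
proof -
  from assms(1) obtain x where "mm - 1/2 = of_int x" by (rule Ints_cases)
  then have mm: "mm = of_int x + 1/2" by simp
  have mp: "mp = real k + 1/2" "mp - 1 = real k - 1/2" using assms(4) by auto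
  let ?H1 = "hecke_B P1 n mm (real k + 1/2)" and ?H2 = "hecke_B P2 (n + k) mm (real k - 1/2)"
  define \<kappa> where "\<kappa> = (\<Prod>i=1..2 * k. crossing (x - int k + int i))"
  have \<kappa>0: "\<kappa> \<noteq> 0" by (simp add: \<kappa>_def crossing_def)
  define c :: rat where "c = (if k = 0 then 1 else -1) / \<kappa>"
  have ranks: "rank ?H1 = n" "rank ?H2 = n + k" by (simp_all add: hecke_B_simps)
  have mu: "rational_fun_eq n (\<lambda>t. mu_reg ?H2 v (phi_coset n k v) (emb n k (special_point n v) t))
      (\<lambda>t. of_rat c * mu_fun ?H1 v t)" if v: "v > 1" for v
  proof -
    define V where "V = complex_of_real v"
    define J where "J = {j :: int. \<bar>j\<bar> \<le> 2 * int k + 1 \<and> odd j}"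
    have J: "finite J" by (rule finite_subset[of _ "{- (2 * int k + 1)..2 * int k + 1}"]) (auto simp: J_def)
    \<comment> \<open>the product of the conditions under which the factors can be cancelled; nonzero at \<open>t = 1\<close> since all \<open>j\<close> are odd\<close>
    define h where "h t = (\<Prod>i=1..n. \<Prod>j\<in>J. (t i + - (V powi j)) * (t i + V powi j))" for t :: "nat \<Rightarrow> complex"
    have "h \<in> regular_funs n"
      unfolding h_def by (intro regular_prod regular_mult regular_add regular_const regular_coord)
    moreover have "\<exists>t\<in>carrier (torus n). h t \<noteq> 0"
    proof (rule bexI[of _ "\<one>\<^bsub>torus n\<^esub>"])
      have "1 + - (V powi j) \<noteq> 0" "1 + V powi j \<noteq> 0" if "j \<in> J" for j
      proof -
        have "j \<noteq> 0" using that by (auto simp: J_def)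
        then have "V powi j \<noteq> V powi 0" unfolding V_def powi_inj[OF v] .
        then show "1 + - (V powi j) \<noteq> 0" by auto
        have "- (V powi j) \<noteq> complex_of_real 1" unfolding V_def by (rule powi_ne_minus[OF v]) simp
        then show "1 + V powi j \<noteq> 0" by (metis add_eq_0_iff of_real_1 minus_minus)
      qed
      then show "h \<one>\<^bsub>torus n\<^esub> \<noteq> 0" using J by (simp add: h_def one_torus)
    qed (simp add: carrier_torus one_torus)
    moreover have "mu_reg ?H2 v (phi_coset n k v) (emb n k (special_point n v) t) = of_rat c * mu_fun ?H1 v t"
      if t: "t \<in> carrier (torus n)" and ht: "h t \<noteq> 0" for t
    proof -
      have gen: "t i \<noteq> V powi j \<and> t i \<noteq> - (V powi j)"
        if "i \<in> {1..n}" "\<bar>j\<bar> \<le> 2 * int k + 1" "odd j" for i j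
      proof -
        have "(t i + - (V powi j)) * (t i + V powi j) \<noteq> 0"
          using ht that J unfolding h_def by (auto simp: J_def prod_zero_iff)
        then show ?thesis by auto
      qed
      let ?F = "\<Prod>\<alpha>\<in>roots_B n. mu_factor ?H1 v \<alpha> t"
      let ?\<epsilon> = "(if k = 0 then 1 else -1) :: complex"
      let ?A = "V ^ (4 * k * (k - 1)) * (V ^ 2 - 1) ^ k"
      let ?D = "\<Prod>b=1..k. (1 + vpow v (- 2 * mm) * V powi (1 - 2 * int b)) *
         (1 + vpow v (- 2 * mm) * V powi (2 * int b - 1))"
      have "mu_reg ?H2 v (phi_coset n k v) (emb n k (special_point n v) t) =
          mu_prefactor ?H2 v * ((V powi (4 * int k - 2)) ^ n * ?F * (?\<epsilon> * ?A / ?D))"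
        unfolding mu_reg_factor[OF v]
        using prod_mu_factor_reg[OF v t gen[unfolded V_def] refl, where ?P2.0 = P2 and ?P1.0 = P1 and mm = mm] unfolding V_def by simp
      also have "\<dots> = ?\<epsilon> * (mu_prefactor ?H2 v * ((V powi (4 * int k - 2)) ^ n * (?A / ?D))) * ?F"
        by simp
      also have "mu_prefactor ?H2 v * ((V powi (4 * int k - 2)) ^ n * (?A / ?D)) = mu_prefactor ?H1 v / of_rat \<kappa>"
        using prefactor_identity[OF v mm assms(5,6)] \<kappa>0
        unfolding \<kappa>_def[symmetric] V_def[symmetric] by (simp add: eq_divide_eq)
      also have "?\<epsilon> * (mu_prefactor ?H1 v / of_rat \<kappa>) * ?F = of_rat c * mu_fun ?H1 v t"
        unfolding mu_fun_factor ranks c_def by (simp add: of_rat_divide)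
      finally show ?thesis .
    qed
    ultimately show ?thesis unfolding rational_fun_eq_def by blast
  qed
  show ?thesis
    unfolding mp(2) unfolding mp(1) spectral_transfer_morphism_def Let_def ranks phi_T_emb phi_coset_def[symmetric]
  proof (intro exI[of _ c] conjI allI impI)
    show "c \<noteq> 0" using \<kappa>0 by (simp add: c_def)
  next
    fix v :: real assume v: "1 < v"
    show "residual_coset ?H2 v (phi_coset n k v)" by (rule residual_phi_coset[OF v])
    show "finite_morphism n (n + k) (emb n k (special_point n v))"
      by (rule finite_morphism_emb[OF special_point_nz[OF v]])
    have "\<one>\<^bsub>torus n\<^esub> \<in> carrier (torus n)" by (simp add: carrier_torus one_torus)
    then show "emb n k (special_point n v) \<one>\<^bsub>torus n\<^esub> \<in> phi_coset n k v \<inter> T_sub ?H2 (phi_coset n k v)"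
      using base_point_T_sub[OF v] by (auto simp: phi_coset_def)
    show "emb n k (special_point n v) \<in> hom (torus n) (based_coset (torus (n + k)) (phi_coset n k v)
        (emb n k (special_point n v) \<one>\<^bsub>torus n\<^esub>))"
      unfolding phi_coset_def by (rule emb_hom_based_coset[OF special_point_nz[OF v]])
    show "rational_fun_eq n (\<lambda>t. mu_reg ?H2 v (phi_coset n k v) (emb n k (special_point n v) t))
        (\<lambda>t. of_rat c * mu_fun ?H1 v t)" by (rule mu[OF v])
  qed
qed

end
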